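(* Let $m,n,l\ge 1$ be integers, let $\beta>0$ and $c_3\ge 0$ be real, and let $s\in\{-1,1\}$. Let $\mathcal{X}=\{\mathbf{x}^{(1)},\dots,\mathbf{x}^{(l)}\}$ with $\mathbf{x}^{(i)}\in\mathbb{R}^n$ for $1\le i\le l$. Let $G$ be an $m\times n$ matrix of i.i.d. standard normals, $\mathbf{u}^{(2)}$ an $m\times 1$ vector of i.i.d. standard normals, $\mathbf{h}$ an $n\times 1$ vector of i.i.d. standard normals, and $u^{(4)}$ a standard normal random variable, with $G$, $\mathbf{u}^{(2)}$, $\mathbf{h}$, $u^{(4)}$ independent of each other. For $t\in[0,1]$ let $$\psi_*(\mathcal{X},\beta,s,c_3,t)=\mathbb{E}_{G,u^{(4)},\mathbf{u}^{(2)},\mathbf{h}}\left(\sum_{i=1}^{l}e^{\beta\left(s\left\|\sqrt{t}\,G\mathbf{x}^{(i)}+\sqrt{1-t}\,\|\mathbf{x}^{(i)}\|_2\,\mathbf{u}^{(2)}\right\|_2+\sqrt{t}\,\|\mathbf{x}^{(i)}\|_2u^{(4)}+\sqrt{1-t}\,\mathbf{h}^T\mathbf{x}^{(i)}\right)}\right)^{c_3}.$$ Then, for $t\in[0,1]$, $$\psi_*(\mathcal{X},\beta,s,c_3,t)=\psi_*(\mathcal{X},\beta,s,c_3,0)+\int_{0}^{t}\frac{d\psi_*(\mathcal{X},\beta,s,c_3,\tau)}{d\tau}\,d\tau,$$ where, for $t\in(0,1)$, $$\frac{d\psi_*(\mathcal{X},\beta,s,c_3,t)}{dt}=-\frac{\beta^2c_3(1-c_3)}{2}\sum_{i=1}^{l}\sum_{p=1}^{l}\mathbb{E}\left[\frac{A^{(i)}_*A^{(p)}_*}{Z_*^{2-c_3}}\left(\|\mathbf{x}^{(i)}\|_2\|\mathbf{x}^{(p)}\|_2-(\mathbf{x}^{(i)})^T\mathbf{x}^{(p)}\right)\left(1-\frac{\left(\sqrt{t}\,\mathbf{u}^{(i,1)}+\sqrt{1-t}\,\mathbf{u}^{(2)}\right)^T\left(\sqrt{t}\,\mathbf{u}^{(p,1)}+\sqrt{1-t}\,\mathbf{u}^{(2)}\right)}{B^{(i)}B^{(p)}}\right)\right],$$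 with $\mathbf{u}^{(i,1)}$, $B^{(i)}$, $A^{(i)}_*$, $Z_*$ as defined in the context.
   Context: $\|\cdot\|_2$ is the Euclidean norm and $\mathbb{E}$ is expectation over all the Gaussian variables. For each $i$ with $\mathbf{x}^{(i)}\neq 0$ and each $t\in(0,1)$ put $$\mathbf{u}^{(i,1)}=\frac{G\mathbf{x}^{(i)}}{\|\mathbf{x}^{(i)}\|_2},\quad \mathbf{u}^{(i,3)}=\frac{\mathbf{h}^T\mathbf{x}^{(i)}}{\|\mathbf{x}^{(i)}\|_2},\quad \beta_i=\beta\|\mathbf{x}^{(i)}\|_2,\quad B^{(i)}=\left\|\sqrt{t}\,\mathbf{u}^{(i,1)}+\sqrt{1-t}\,\mathbf{u}^{(2)}\right\|_2,$$ $$A^{(i)}_*=e^{\beta_i\left(sB^{(i)}+\sqrt{t}\,u^{(4)}+\sqrt{1-t}\,\mathbf{u}^{(i,3)}\right)},\qquad Z_*=\sum_{i=1}^{l}A^{(i)}_*,$$ so that $\psi_*=\mathbb{E}\,Z_*^{c_3}$. If $\mathbf{x}^{(i)}=0$, then $A^{(i)}_*=1$, and every summand of the derivative formula involving such an index is read as $0$ (its factor $\|\mathbf{x}^{(i)}\|_2\|\mathbf{x}^{(p)}\|_2-(\mathbf{x}^{(i)})^T\mathbf{x}^{(p)}$ vanishes). *)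

theory Defs
  imports "HOL-Probability.Probability"
begin

text \<open>
  The scalar entries of \<open>G\<close>, \<open>u2\<close>, \<open>h\<close>, \<open>u4\<close> as one family of random variables. Independence of this
  family says that the entries of each object are independent and that the four objects are
  independent of each other.
\<close>
fun gaussian_entry ::
  "('w \<Rightarrow> real^'n^'m) \<Rightarrow> ('w \<Rightarrow> real^'m) \<Rightarrow> ('w \<Rightarrow> real^'n) \<Rightarrow> ('w \<Rightarrow> real)
    \<Rightarrow> ('m \<times> 'n) + 'm + 'n + unit \<Rightarrow> 'w \<Rightarrow> real" where
  "gaussian_entry G u2 h u4 (Inl (i, j)) \<omega> = G \<omega> $ i $ j"
| "gaussian_entry G u2 h u4 (Inr (Inl i)) \<omega> = u2 \<omega> $ i"
| "gaussian_entry G u2 h u4 (Inr (Inr (Inl j))) \<omega> = h \<omega> $ j"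
| "gaussian_entry G u2 h u4 (Inr (Inr (Inr _))) \<omega> = u4 \<omega>"

definition psi_integrand ::
  "(nat \<Rightarrow> real^'n) \<Rightarrow> nat \<Rightarrow> real \<Rightarrow> real \<Rightarrow> real \<Rightarrow> real
    \<Rightarrow> real^'n^'m \<Rightarrow> real^'m \<Rightarrow> real^'n \<Rightarrow> real \<Rightarrow> real" where
  "psi_integrand x l \<beta> s c3 t G u2 h u4 =
    (\<Sum>i=1..l. exp (\<beta> * (s * norm (sqrt t *\<^sub>R (G *v x i) + (sqrt (1 - t) * norm (x i)) *\<^sub>R u2)
                        + sqrt t * norm (x i) * u4 + sqrt (1 - t) * (h \<bullet> x i)))) powr c3"

definition psi ::
  "'w measure \<Rightarrow> ('w \<Rightarrow> real^'n^'m) \<Rightarrow> ('w \<Rightarrow> real^'m) \<Rightarrow> ('w \<Rightarrow> real^'n) \<Rightarrow> ('w \<Rightarrow> real)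
    \<Rightarrow> (nat \<Rightarrow> real^'n) \<Rightarrow> nat \<Rightarrow> real \<Rightarrow> real \<Rightarrow> real \<Rightarrow> real \<Rightarrow> real" where
  "psi M G u2 h u4 x l \<beta> s c3 t =
    (\<integral>\<omega>. psi_integrand x l \<beta> s c3 t (G \<omega>) (u2 \<omega>) (h \<omega>) (u4 \<omega>) \<partial>M)"

text \<open>
  In the definitions below \<open>y\<close> is a single vector of the family. For \<open>y = 0\<close>, division by zero gives
  \<open>u1 G y = 0\<close> and \<open>u3 h y = 0\<close>, hence \<open>A_star = 1\<close> because of the factor \<open>norm y\<close> in its
  exponent, and every \<open>deriv_summand\<close> involving \<open>y\<close> is \<open>0\<close>.
\<close>
definition u1 :: "real^'n^'m \<Rightarrow> real^'n \<Rightarrow> real^'m" where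
  "u1 G y = (G *v y) /\<^sub>R norm y"

definition u3 :: "real^'n \<Rightarrow> real^'n \<Rightarrow> real" where
  "u3 h y = (h \<bullet> y) / norm y"

definition B_vec :: "real \<Rightarrow> real^'n^'m \<Rightarrow> real^'m \<Rightarrow> real^'n \<Rightarrow> real^'m" where
  "B_vec t G u2 y = sqrt t *\<^sub>R u1 G y + sqrt (1 - t) *\<^sub>R u2"

definition B_norm :: "real \<Rightarrow> real^'n^'m \<Rightarrow> real^'m \<Rightarrow> real^'n \<Rightarrow> real" where
  "B_norm t G u2 y = norm (B_vec t G u2 y)"

definition A_star ::
  "real \<Rightarrow> real \<Rightarrow> real \<Rightarrow> real^'n^'m \<Rightarrow> real^'m \<Rightarrow> real^'n \<Rightarrow> real \<Rightarrow> real^'n \<Rightarrow> real" where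
  "A_star \<beta> s t G u2 h u4 y =
    exp ((\<beta> * norm y) * (s * B_norm t G u2 y + sqrt t * u4 + sqrt (1 - t) * u3 h y))"

definition Z_star ::
  "(nat \<Rightarrow> real^'n) \<Rightarrow> nat \<Rightarrow> real \<Rightarrow> real \<Rightarrow> real
    \<Rightarrow> real^'n^'m \<Rightarrow> real^'m \<Rightarrow> real^'n \<Rightarrow> real \<Rightarrow> real" where
  "Z_star x l \<beta> s t G u2 h u4 = (\<Sum>i=1..l. A_star \<beta> s t G u2 h u4 (x i))"

definition deriv_summand ::
  "(nat \<Rightarrow> real^'n) \<Rightarrow> nat \<Rightarrow> real \<Rightarrow> real \<Rightarrow> real \<Rightarrow> real
    \<Rightarrow> real^'n^'m \<Rightarrow> real^'m \<Rightarrow> real^'n \<Rightarrow> real \<Rightarrow> nat \<Rightarrow> nat \<Rightarrow> real" where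
  "deriv_summand x l \<beta> s c3 t G u2 h u4 i p =
    A_star \<beta> s t G u2 h u4 (x i) * A_star \<beta> s t G u2 h u4 (x p)
      / Z_star x l \<beta> s t G u2 h u4 powr (2 - c3)
    * (norm (x i) * norm (x p) - x i \<bullet> x p)
    * (1 - (B_vec t G u2 (x i) \<bullet> B_vec t G u2 (x p)) / (B_norm t G u2 (x i) * B_norm t G u2 (x p)))"

end

theory Submission
  imports Defs "HOL-Real_Asymp.Real_Asymp"
begin

text \<open>
  Write all scalar Gaussians as one finite family \<open>\<gamma> k\<close>. The time \<open>t\<close> enters only through weights:
  the entries of \<open>G\<close> and \<open>u4\<close> are multiplied by \<open>sqrt t\<close>, those of \<open>u2\<close> and \<open>h\<close> by \<open>sqrt (1 - t)\<close>.
  If \<open>f\<close> and its partial derivatives up to order two have exponential growth, then differentiating \<open>E f\<close> along such a weighted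
  family and integrating by parts in every Gaussian coordinate gives half the signed sum of the
  pure second partial derivatives of \<open>f\<close>, with sign \<open>+\<close> for a growing and \<open>-\<close> for a shrinking weight
  (\<open>interpolation_derivative\<close>).

  The function at hand is \<open>f = Z powr c3\<close>, where \<open>Z\<close> is a sum of exponentials of \<open>s\<close> times the norm of
  a linear vector \<open>V i\<close> plus a linear scalar \<open>W i\<close>. The signed sums of products of coefficients
  are the time derivatives of covariances: with
  \<open>D i p = norm (x i) * norm (x p) - x i \<bullet> x p\<close> they equal \<open>- D i p\<close> for the vectors and \<open>D i p\<close> for
  the scalars. Hence the terms of the second derivative
  that come from a pair \<open>(i, p)\<close> combine to \<open>D i p\<close> times one minus the cosine of the angle between
  \<open>V i\<close> and \<open>V p\<close>, and everything that involves one index only, in particular the second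
  derivative of a norm, is multiplied by \<open>D i i = 0\<close> (\<open>signed_F''\<close>).

  The norm is not differentiable at \<open>0\<close>, and in dimension one its derivative jumps there, so
  integration by parts is not applied to it directly. It is replaced by
  \<open>sqrt (norm V ^ 2 + \<epsilon>)\<close>, for which the computation above is rigorous. The resulting identity
  in integrated form passes to the limit \<open>\<epsilon> = 0\<close>: the functional and its derivative are dominated
  uniformly in \<open>\<epsilon>\<close>, because the remaining summands contain no second derivative of a norm, and the vectors \<open>V i\<close> that matter
  are almost surely nonzero at every time (\<open>\<Psi>_integral\<close>). The limiting derivative is continuous on
  the whole closed interval \<open>[0, 1]\<close>, so the fundamental theorem of calculus turns the integrated
  identity back into a derivative.
\<close>

section \<open>Expectations that depend on a parameter\<close>

text \<open>
  The mean value theorem bounds every difference quotient by the dominating function of the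
  derivative, so dominated convergence applies to the quotients.
\<close>
lemma has_real_derivative_lebesgue_integral:
  fixes f f' :: "real \<Rightarrow> 'a \<Rightarrow> real" and g :: "'a \<Rightarrow> real"
  assumes S: "open S" "convex S" "t \<in> S"
    and f: "\<And>s. s \<in> S \<Longrightarrow> integrable M (f s)"
    and f': "f' t \<in> borel_measurable M"
    and deriv: "\<And>s \<omega>. s \<in> S \<Longrightarrow> \<omega> \<in> space M \<Longrightarrow> ((\<lambda>s. f s \<omega>) has_real_derivative f' s \<omega>) (at s)"
    and bound: "\<And>s \<omega>. s \<in> S \<Longrightarrow> \<omega> \<in> space M \<Longrightarrow> \<bar>f' s \<omega>\<bar> \<le> g \<omega>"
    and g: "integrable M g"
  shows "((\<lambda>s. \<integral>\<omega>. f s \<omega> \<partial>M) has_real_derivative (\<integral>\<omega>. f' t \<omega> \<partial>M)) (at t)"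
proof -
  have "((\<lambda>s. ((\<integral>\<omega>. f s \<omega> \<partial>M) - (\<integral>\<omega>. f t \<omega> \<partial>M)) / (s - t)) \<longlongrightarrow> (\<integral>\<omega>. f' t \<omega> \<partial>M)) (at t within S)"
    unfolding tendsto_at_iff_sequentially comp_def
  proof (intro allI impI)
    fix X assume X: "\<forall>n. X n \<in> S - {t}" and "X \<longlonglongrightarrow> t"
    have "(\<lambda>n. \<integral>\<omega>. (f (X n) \<omega> - f t \<omega>) / (X n - t) \<partial>M) \<longlonglongrightarrow> (\<integral>\<omega>. f' t \<omega> \<partial>M)"
    proof (rule integral_dominated_convergence[where w = g])
      show "(\<lambda>\<omega>. (f (X n) \<omega> - f t \<omega>) / (X n - t)) \<in> borel_measurable M" for n
        using X S f by (intro borel_measurable_divide borel_measurable_diff) auto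
      show "AE \<omega> in M. (\<lambda>n. (f (X n) \<omega> - f t \<omega>) / (X n - t)) \<longlonglongrightarrow> f' t \<omega>"
      proof (rule AE_I2)
        fix \<omega> assume "\<omega> \<in> space M"
        then have "((\<lambda>s. (f s \<omega> - f t \<omega>) / (s - t)) \<longlongrightarrow> f' t \<omega>) (at t)"
          using deriv S unfolding has_field_derivative_iff by blast
        then show "(\<lambda>n. (f (X n) \<omega> - f t \<omega>) / (X n - t)) \<longlonglongrightarrow> f' t \<omega>"
          using X \<open>X \<longlonglongrightarrow> t\<close> unfolding tendsto_at_iff_sequentially comp_def by blast
      qed
      show "AE \<omega> in M. norm ((f (X n) \<omega> - f t \<omega>) / (X n - t)) \<le> g \<omega>" for n
      proof (rule AE_I2)
        fix \<omega> assume \<omega>: "\<omega> \<in> space M"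
        have "norm (f (X n) \<omega> - f t \<omega>) \<le> g \<omega> * norm (X n - t)"
          using X S \<omega> deriv bound
          by (intro field_differentiable_bound[of S "\<lambda>s. f s \<omega>" "\<lambda>s. f' s \<omega>"])
             (auto intro: has_field_derivative_at_within)
        then show "norm ((f (X n) \<omega> - f t \<omega>) / (X n - t)) \<le> g \<omega>"
          using X by (simp add: field_simps abs_divide)
      qed
    qed (use f' g in auto)
    moreover have "(\<integral>\<omega>. (f (X n) \<omega> - f t \<omega>) / (X n - t) \<partial>M)
        = ((\<integral>\<omega>. f (X n) \<omega> \<partial>M) - (\<integral>\<omega>. f t \<omega> \<partial>M)) / (X n - t)" for n
      using X S f by (subst integral_divide_zero, subst Bochner_Integration.integral_diff) auto
    ultimately show "(\<lambda>n. ((\<integral>\<omega>. f (X n) \<omega> \<partial>M) - (\<integral>\<omega>. f t \<omega> \<partial>M)) / (X n - t))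
        \<longlonglongrightarrow> (\<integral>\<omega>. f' t \<omega> \<partial>M)"
      by (simp only:)
  qed
  then show ?thesis
    unfolding has_field_derivative_iff at_within_open[OF S(3,1)] .
qed

text \<open>
  Continuity at each parameter is only asked almost surely, and the exceptional set may depend on
  the parameter. This is what the norms below need, since each of them has a point of
  discontinuity of its gradient that a fixed time meets with probability zero.
\<close>
lemma continuous_on_lebesgue_integral:
  fixes f :: "real \<Rightarrow> 'a \<Rightarrow> real" and g :: "'a \<Rightarrow> real"
  assumes f: "\<And>t. t \<in> S \<Longrightarrow> f t \<in> borel_measurable M"
    and cont: "\<And>t. t \<in> S \<Longrightarrow> AE \<omega> in M. continuous (at t within S) (\<lambda>t. f t \<omega>)"
    and bound: "\<And>t \<omega>. t \<in> S \<Longrightarrow> \<omega> \<in> space M \<Longrightarrow> \<bar>f t \<omega>\<bar> \<le> g \<omega>"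
    and g: "integrable M g"
  shows "continuous_on S (\<lambda>t. \<integral>\<omega>. f t \<omega> \<partial>M)"
  unfolding continuous_on_sequentially comp_def
proof (intro allI ballI impI)
  fix X t assume t: "t \<in> S" and X: "(\<forall>n. X n \<in> S) \<and> X \<longlonglongrightarrow> t"
  show "(\<lambda>n. \<integral>\<omega>. f (X n) \<omega> \<partial>M) \<longlonglongrightarrow> (\<integral>\<omega>. f t \<omega> \<partial>M)"
  proof (rule integral_dominated_convergence[where w = g])
    show "AE \<omega> in M. (\<lambda>n. f (X n) \<omega>) \<longlonglongrightarrow> f t \<omega>"
      using cont[OF t]
    proof (rule AE_mp, intro AE_I2 impI)
      fix \<omega> assume "continuous (at t within S) (\<lambda>t. f t \<omega>)"
      then show "(\<lambda>n. f (X n) \<omega>) \<longlonglongrightarrow> f t \<omega>"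
        using X unfolding continuous_within_sequentially comp_def by blast
    qed
    show "AE \<omega> in M. norm (f (X n) \<omega>) \<le> g \<omega>" for n
      using X bound by (intro AE_I2) auto
  qed (use f g t X in auto)
qed

section \<open>The one-dimensional standard normal distribution\<close>

abbreviation std_normal :: "real measure" where
  "std_normal \<equiv> density lborel std_normal_density"

lemma integrable_exp_mult_std_normal: "integrable std_normal (\<lambda>y. exp (c * y))"
proof -
  have "std_normal_density y * exp (c * y) = exp (c\<^sup>2 / 2) * normal_density c 1 y" for y
    by (simp add: normal_density_def flip: exp_add) (simp add: power2_eq_square field_simps)
  then show ?thesis
    by (subst integrable_real_density) (auto simp: normal_density_nonneg)
qed

lemma integrable_exp_abs_std_normal: "integrable std_normal (\<lambda>y. exp (c * \<bar>y\<bar>))"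
proof (rule Bochner_Integration.integrable_bound)
  show "integrable std_normal (\<lambda>y. exp (c * y) + exp ((- c) * y))"
    by (intro Bochner_Integration.integrable_add integrable_exp_mult_std_normal)
  have "exp (c * \<bar>y\<bar>) \<le> exp (c * y) + exp ((- c) * y)" for y
    by (cases "0 \<le> y") simp_all
  then show "AE y in std_normal. norm (exp (c * \<bar>y\<bar>)) \<le> norm (exp (c * y) + exp ((- c) * y))"
    by (intro AE_I2) (simp only: real_norm_def abs_exp_cancel order_trans[OF _ abs_ge_self])
qed simp

text \<open>
  Stein's identity. The function \<open>f' y - y * f y\<close> times the density is the derivative of \<open>f\<close> times the
  density, and the latter vanishes at both infinities because the density beats exponential
  growth.
\<close>
lemma std_normal_integration_by_parts:
  fixes f f' :: "real \<Rightarrow> real"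
  assumes f: "\<And>y. (f has_real_derivative f' y) (at y)" "continuous_on UNIV f'"
    and bound: "\<And>y. \<bar>f y\<bar> \<le> C * exp (c * \<bar>y\<bar>)" "\<And>y. \<bar>f' y\<bar> \<le> C * exp (c * \<bar>y\<bar>)"
  shows "(\<integral>y. y * f y \<partial>std_normal) = (\<integral>y. f' y \<partial>std_normal)"
proof -
  have cont: "continuous_on UNIV f"
    using f(1) by (meson DERIV_continuous_on has_field_derivative_at_within)
  have [measurable]: "f \<in> borel_measurable borel" "f' \<in> borel_measurable borel"
    using cont f(2) by (auto intro: borel_measurable_continuous_onI)
  have C: "0 \<le> C"
    using bound(1)[of 0] by simp
  have int_f': "integrable std_normal f'"
    by (rule Bochner_Integration.integrable_bound[of _ "\<lambda>y. C * exp (c * \<bar>y\<bar>)"])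
       (use bound(2) C in \<open>auto intro!: integrable_exp_abs_std_normal\<close>)
  have int_f: "integrable std_normal (\<lambda>y. y * f y)"
  proof (rule Bochner_Integration.integrable_bound[of _ "\<lambda>y. C * exp ((c + 1) * \<bar>y\<bar>)"])
    have "\<bar>y\<bar> * \<bar>f y\<bar> \<le> exp \<bar>y\<bar> * (C * exp (c * \<bar>y\<bar>))" for y
      using bound(1)[of y] exp_ge_add_one_self[of "\<bar>y\<bar>"] by (intro mult_mono) linarith+
    then show "AE y in std_normal. norm (y * f y) \<le> norm (C * exp ((c + 1) * \<bar>y\<bar>))"
      using C by (auto simp: abs_mult exp_add algebra_simps)
  qed (auto intro!: integrable_exp_abs_std_normal)
  let ?g = "\<lambda>y. std_normal_density y * f' y - std_normal_density y * (y * f y)"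
  have int_g: "integrable lborel ?g"
    using int_f int_f' by (auto simp: integrable_real_density)
  have le: "\<bar>f y * std_normal_density y\<bar> \<le> C * exp (c\<^sup>2) * exp (- y\<^sup>2 / 4)" for y
  proof -
    have "std_normal_density y \<le> exp (- y\<^sup>2 / 2)"
      using pi_ge_two by (simp add: std_normal_density_def field_simps)
    then have "\<bar>f y\<bar> * std_normal_density y \<le> (C * exp (c * \<bar>y\<bar>)) * exp (- y\<^sup>2 / 2)"
      using bound(1)[of y] C by (intro mult_mono) auto
    also have "\<dots> = C * exp (c * \<bar>y\<bar> - y\<^sup>2 / 2)"
      by (simp flip: exp_add)
    also have "\<dots> \<le> C * exp (c\<^sup>2 - y\<^sup>2 / 4)"
    proof -
      have "0 \<le> (c - \<bar>y\<bar> / 2)\<^sup>2"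
        by simp
      \<comment> \<open>Completing the square absorbs the linear term into half of the quadratic one.\<close>
      then have "c * \<bar>y\<bar> - y\<^sup>2 / 2 \<le> c\<^sup>2 - y\<^sup>2 / 4"
        by (simp add: power2_diff power_divide)
      then show ?thesis
        using C by (intro mult_left_mono) auto
    qed
    also have "\<dots> = C * exp (c\<^sup>2) * exp (- y\<^sup>2 / 4)"
      by (simp flip: exp_add)
    finally show ?thesis
      by (simp add: abs_mult)
  qed
  have "((\<lambda>y::real. exp (- y\<^sup>2 / 4)) \<longlongrightarrow> 0) at_top" "((\<lambda>y::real. exp (- y\<^sup>2 / 4)) \<longlongrightarrow> 0) at_bot"
    by real_asymp+
  then have lim: "((\<lambda>y. C * exp (c\<^sup>2) * exp (- y\<^sup>2 / 4)) \<longlongrightarrow> 0) F" if "F = at_top \<or> F = at_bot" for F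
    using that by (intro tendsto_mult_right_zero) auto
  have density: "(std_normal_density has_real_derivative - y * std_normal_density y) (at y)" for y
  proof -
    have "((\<lambda>y. exp (- y\<^sup>2 / 2)) has_real_derivative - y * exp (- y\<^sup>2 / 2)) (at y)"
      by (auto intro!: derivative_eq_intros)
    from DERIV_cmult[OF this, of "1 / sqrt (2 * pi)"] show ?thesis
      by (simp add: std_normal_density_def[abs_def])
  qed
  have "(LBINT y=-\<infinity>..\<infinity>. ?g y) = 0 - 0"
  proof (rule interval_integral_FTC_integrable)
    show "((\<lambda>y. f y * std_normal_density y) has_vector_derivative ?g y) (at y)" for y
      unfolding has_real_derivative_iff_has_vector_derivative[symmetric]
      using DERIV_mult[OF f(1) density, of y] by (simp add: algebra_simps)
    have "isCont f y" "isCont f' y" "isCont std_normal_density y" for y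
      using cont f(2) DERIV_isCont[OF density] by (simp_all add: continuous_on_eq_continuous_at)
    then show "isCont ?g y" for y
      by (intro continuous_intros)
    show "set_integrable lborel (einterval (-\<infinity>) \<infinity>) ?g"
      using int_g by (simp add: set_integrable_def)
    have "((\<lambda>y. f y * std_normal_density y) \<longlongrightarrow> 0) F" if "F = at_top \<or> F = at_bot" for F
      by (rule Lim_null_comparison[OF always_eventually lim[OF that]]) (simp only: real_norm_def le simp_thms)
    note this[of at_bot, simplified] this[of at_top, simplified]
    then show "(((\<lambda>y. f y * std_normal_density y) \<circ> real_of_ereal) \<longlongrightarrow> 0) (at_right (-\<infinity>))"
      "(((\<lambda>y. f y * std_normal_density y) \<circ> real_of_ereal) \<longlongrightarrow> 0) (at_left \<infinity>)"
      by (simp_all only: ereal_tendsto_simps1)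
  qed simp
  then have "0 = (\<integral>y. ?g y \<partial>lborel)"
    by (simp only: interval_lebesgue_integral_def set_lebesgue_integral_def) simp
  also have "\<dots> = (\<integral>y. std_normal_density y * f' y \<partial>lborel) - (\<integral>y. std_normal_density y * (y * f y) \<partial>lborel)"
    using int_f int_f' by (intro Bochner_Integration.integral_diff) (auto simp: integrable_real_density)
  also have "\<dots> = (\<integral>y. f' y \<partial>std_normal) - (\<integral>y. y * f y \<partial>std_normal)"
    by (subst (1 2) integral_real_density) auto
  finally show ?thesis
    by linarith
qed

section \<open>Finite families of independent standard normals\<close>

text \<open>
  The growth class is measured by the sum of the absolute values of the coordinates, because the
  exponential of that sum factors over independent coordinates and is therefore integrable.
\<close>
definition exp_growth :: "(('k::finite \<Rightarrow> real) \<Rightarrow> real) \<Rightarrow> bool" where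
  "exp_growth f \<longleftrightarrow> (\<exists>C c. 0 \<le> C \<and> 0 \<le> c \<and> (\<forall>z. \<bar>f z\<bar> \<le> C * exp (c * (\<Sum>k\<in>UNIV. \<bar>z k\<bar>))))"

lemma exp_growthE:
  assumes "exp_growth f"
  obtains C c where "0 \<le> C" "0 \<le> c" "\<And>z. \<bar>f z\<bar> \<le> C * exp (c * (\<Sum>k\<in>UNIV. \<bar>z k\<bar>))"
  using assms unfolding exp_growth_def by blast

lemma exp_growth_mult_coord:
  assumes "exp_growth f"
  shows "exp_growth (\<lambda>z. z k * f z)"
proof -
  obtain C c where C: "0 \<le> C" "0 \<le> c" "\<And>z. \<bar>f z\<bar> \<le> C * exp (c * (\<Sum>k\<in>UNIV. \<bar>z k\<bar>))"
    using assms by (rule exp_growthE) blast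
  have "\<bar>z k * f z\<bar> \<le> C * exp ((c + 1) * (\<Sum>k\<in>UNIV. \<bar>z k\<bar>))" for z
  proof -
    have "\<bar>z k\<bar> \<le> (\<Sum>k\<in>UNIV. \<bar>z k\<bar>)"
      by (rule member_le_sum) auto
    also have "\<dots> \<le> exp (\<Sum>k\<in>UNIV. \<bar>z k\<bar>)"
      using exp_ge_add_one_self[of "\<Sum>k\<in>UNIV. \<bar>z k\<bar>"] by linarith
    finally have "\<bar>z k\<bar> * \<bar>f z\<bar> \<le> exp (\<Sum>k\<in>UNIV. \<bar>z k\<bar>) * (C * exp (c * (\<Sum>k\<in>UNIV. \<bar>z k\<bar>)))"
      using C(3)[of z] by (intro mult_mono) auto
    also have "\<dots> = C * exp ((c + 1) * (\<Sum>k\<in>UNIV. \<bar>z k\<bar>))"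
      by (simp add: distrib_right exp_add)
    finally show ?thesis
      by (simp add: abs_mult)
  qed
  with C(1,2) show ?thesis
    unfolding exp_growth_def by (intro exI[of _ C] exI[of _ "c + 1"]) auto
qed

text \<open>
  The family is indexed by a finite type, so that its joint law is a product measure on plain
  functions \<open>'k \<Rightarrow> real\<close>, without a restriction to an index set.
\<close>
locale iid_std_normals = prob_space M
  for M :: "'w measure" +
  fixes \<gamma> :: "'k::finite \<Rightarrow> 'w \<Rightarrow> real"
  assumes indep: "indep_vars (\<lambda>_. borel) \<gamma> UNIV"
    and std_normal: "\<And>k. distributed M lborel (\<gamma> k) std_normal_density"
begin

lemma measurable_coord [measurable]: "\<gamma> k \<in> borel_measurable M"
  using std_normal by (metis distributed_measurable measurable_lborel1)

lemma measurable_joint [measurable]: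
  "(\<lambda>\<omega> k. \<gamma> k \<omega>) \<in> measurable M (PiM UNIV (\<lambda>_. borel))"
  using measurable_restrict[of UNIV \<gamma> M "\<lambda>_. borel"] by (simp add: restrict_def)

lemma joint_law: "distr M (PiM UNIV (\<lambda>_. borel)) (\<lambda>\<omega> k. \<gamma> k \<omega>) = PiM UNIV (\<lambda>_. std_normal)"
proof -
  have "distr M borel (\<gamma> k) = std_normal" for k
    using std_normal[of k] unfolding distributed_def
    by (metis distr_cong sets_lborel)
  then show ?thesis
    using indep indep_vars_iff_distr_eq_PiM[where I = UNIV and M' = "\<lambda>_. borel" and X = \<gamma>]
    by (simp add: restrict_def)
qed

lemma integrable_exp_sum_abs: "integrable M (\<lambda>\<omega>. exp (c * (\<Sum>k\<in>UNIV. \<bar>\<gamma> k \<omega>\<bar>)))"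
proof -
  have "indep_vars (\<lambda>_. borel) (\<lambda>k \<omega>. exp (c * \<bar>\<gamma> k \<omega>\<bar>)) UNIV"
    using indep by (rule indep_vars_compose2) auto
  moreover have "integrable M (\<lambda>\<omega>. exp (c * \<bar>\<gamma> k \<omega>\<bar>))" for k
    using integrable_exp_abs_std_normal[of c] distributed_integrable[OF std_normal, of "\<lambda>y. exp (c * \<bar>y\<bar>)" k]
    by (simp add: integrable_real_density)
  ultimately show ?thesis
    using indep_vars_integrable[of UNIV "\<lambda>k \<omega>. exp (c * \<bar>\<gamma> k \<omega>\<bar>)"]
    by (simp add: exp_sum sum_distrib_left)
qed

lemma integrable_exp_growth:
  assumes "exp_growth f" and [measurable]: "f \<in> borel_measurable (PiM UNIV (\<lambda>_. borel))"
  shows "integrable M (\<lambda>\<omega>. f (\<lambda>k. \<gamma> k \<omega>))"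
proof -
  obtain C c where C: "0 \<le> C" "0 \<le> c" "\<And>z. \<bar>f z\<bar> \<le> C * exp (c * (\<Sum>k\<in>UNIV. \<bar>z k\<bar>))"
    using assms(1) by (rule exp_growthE) blast
  show ?thesis
    by (rule Bochner_Integration.integrable_bound[of _ "\<lambda>\<omega>. C * exp (c * (\<Sum>k\<in>UNIV. \<bar>\<gamma> k \<omega>\<bar>))"])
       (use C in \<open>auto intro!: integrable_exp_sum_abs\<close>)
qed

text \<open>
  Fubini's theorem for the joint law: one coordinate is integrated first. It reduces statements about
  the family to statements about one standard normal.
\<close>
lemma expectation_insert:
  assumes "exp_growth f" and [measurable]: "f \<in> borel_measurable (PiM UNIV (\<lambda>_. borel))"
  shows "expectation (\<lambda>\<omega>. f (\<lambda>k. \<gamma> k \<omega>)) =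
    (\<integral>z. (\<integral>y. f (z(k := y)) \<partial>std_normal) \<partial>PiM (UNIV - {k}) (\<lambda>_. std_normal))"
proof -
  interpret N: prob_space std_normal
    by (rule prob_space_normal_density) simp
  interpret product_sigma_finite "\<lambda>_::'k. std_normal" ..
  have U: "insert k (UNIV - {k}) = (UNIV :: 'k set)"
    by auto
  have "integrable (PiM UNIV (\<lambda>_. std_normal)) f"
    unfolding joint_law[symmetric] by (subst integrable_distr_eq) (auto intro: integrable_exp_growth assms)
  with product_integral_insert[of "UNIV - {k}" k f]
  have "(\<integral>z. f z \<partial>PiM UNIV (\<lambda>_. std_normal)) =
    (\<integral>z. (\<integral>y. f (z(k := y)) \<partial>std_normal) \<partial>PiM (UNIV - {k}) (\<lambda>_. std_normal))"
    unfolding U by simp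
  then show ?thesis
    unfolding joint_law[symmetric] by (subst (asm) integral_distr) auto
qed

text \<open>
  With the other coordinates frozen, a function of exponential growth still has exponential growth in
  the remaining one, with constants that depend on the frozen values. The one-dimensional identity
  thus applies on every line parallel to the coordinate axis \<open>k\<close>.
\<close>
lemma expectation_integration_by_parts:
  assumes f: "exp_growth f" "f \<in> borel_measurable (PiM UNIV (\<lambda>_. borel))"
    and f': "exp_growth f'" "f' \<in> borel_measurable (PiM UNIV (\<lambda>_. borel))"
    and deriv: "\<And>z y. ((\<lambda>y. f (z(k := y))) has_real_derivative f' (z(k := y))) (at y)"
    and cont: "\<And>z. continuous_on UNIV (\<lambda>y. f' (z(k := y)))"
  shows "expectation (\<lambda>\<omega>. \<gamma> k \<omega> * f (\<lambda>k. \<gamma> k \<omega>)) = expectation (\<lambda>\<omega>. f' (\<lambda>k. \<gamma> k \<omega>))"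
proof -
  obtain C c C' c' where C: "0 \<le> C" "0 \<le> c" "\<And>z. \<bar>f z\<bar> \<le> C * exp (c * (\<Sum>k\<in>UNIV. \<bar>z k\<bar>))"
    and C': "0 \<le> C'" "0 \<le> c'" "\<And>z. \<bar>f' z\<bar> \<le> C' * exp (c' * (\<Sum>k\<in>UNIV. \<bar>z k\<bar>))"
    using exp_growthE[OF f(1)] exp_growthE[OF f'(1)] by metis
  have line: "(\<integral>y. y * f (z(k := y)) \<partial>std_normal) = (\<integral>y. f' (z(k := y)) \<partial>std_normal)" for z
  proof -
    define S where "S = (\<Sum>j\<in>UNIV - {k}. \<bar>z j\<bar>)"
    define D d where "D = (C + C') * exp ((c + c') * S)" and "d = c + c'"
    have S: "(\<Sum>j\<in>UNIV. \<bar>(z(k := y)) j\<bar>) = \<bar>y\<bar> + S" "0 \<le> S" for y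
      unfolding S_def by (simp_all add: sum.remove[of UNIV k] sum_nonneg)
    have "D * exp (d * \<bar>y\<bar>) = (C + C') * exp ((c + c') * (\<bar>y\<bar> + S))" for y
      unfolding D_def d_def by (simp add: algebra_simps flip: exp_add)
    moreover have "C * exp (c * (\<bar>y\<bar> + S)) \<le> (C + C') * exp ((c + c') * (\<bar>y\<bar> + S))"
      "C' * exp (c' * (\<bar>y\<bar> + S)) \<le> (C + C') * exp ((c + c') * (\<bar>y\<bar> + S))" for y
      using C(1,2) C'(1,2) S(2) by (auto intro!: mult_mono mult_right_mono)
    ultimately have "\<bar>f (z(k := y))\<bar> \<le> D * exp (d * \<bar>y\<bar>)" "\<bar>f' (z(k := y))\<bar> \<le> D * exp (d * \<bar>y\<bar>)" for y
      using C(3)[of "z(k := y)"] C'(3)[of "z(k := y)"] unfolding S by (metis order_trans)+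
    then show ?thesis
      using deriv cont by (intro std_normal_integration_by_parts[where C = D and c = d])
  qed
  have "exp_growth (\<lambda>z. z k * f z)" "(\<lambda>z. z k * f z) \<in> borel_measurable (PiM UNIV (\<lambda>_. borel))"
    using f(2) by (auto intro: exp_growth_mult_coord f)
  from expectation_insert[OF this, of k] expectation_insert[OF f', of k] show ?thesis
    using line by simp
qed

text \<open>
  Once the other coordinates are fixed, the form vanishes for a single value of coordinate \<open>k\<close>, and a
  point has measure zero.
\<close>
lemma AE_linear_form_nonzero:
  assumes "a k \<noteq> 0"
  shows "AE \<omega> in M. (\<Sum>j\<in>UNIV. a j * \<gamma> j \<omega>) \<noteq> 0"
proof -
  interpret N: prob_space std_normal
    by (rule prob_space_normal_density) simp
  interpret product_sigma_finite "\<lambda>_::'k. std_normal" ..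
  have U: "insert k (UNIV - {k}) = (UNIV :: 'k set)"
    by auto
  define f :: "('k \<Rightarrow> real) \<Rightarrow> ennreal" where "f z = indicator {0} (\<Sum>j\<in>UNIV. a j * z j)" for z
  have [measurable]: "f \<in> borel_measurable (PiM UNIV (\<lambda>_. borel))"
    unfolding f_def by measurable
  have "f (z(k := y)) \<le> indicator {- (\<Sum>j\<in>UNIV - {k}. a j * z j) / a k} y" for z y
    using assms unfolding f_def by (auto simp: indicator_def sum.remove[of UNIV k] field_simps)
  moreover have "(\<integral>\<^sup>+y. indicator {- (\<Sum>j\<in>UNIV - {k}. a j * z j) / a k} y \<partial>std_normal) = 0" for z
    by (simp add: nn_integral_density emeasure_density)
  ultimately have "(\<integral>\<^sup>+y. f (z(k := y)) \<partial>std_normal) = 0" for z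
    by (metis (no_types, lifting) nn_integral_mono le_zero_eq)
  with product_nn_integral_insert[of "UNIV - {k}" k f]
  have "(\<integral>\<^sup>+z. f z \<partial>PiM UNIV (\<lambda>_. std_normal)) = 0"
    unfolding U by (simp cong: measurable_cong_sets)
  then have "(\<integral>\<^sup>+\<omega>. f (\<lambda>k. \<gamma> k \<omega>) \<partial>M) = 0"
    unfolding joint_law[symmetric] by (subst (asm) nn_integral_distr) auto
  then have "AE \<omega> in M. f (\<lambda>k. \<gamma> k \<omega>) = 0"
    by (subst (asm) nn_integral_0_iff_AE) auto
  then show ?thesis
    by eventually_elim (auto simp: f_def indicator_def split: if_splits)
qed

end

section \<open>Gaussian interpolation\<close>

lemma exp_growth_scale:
  fixes f :: "('k::finite \<Rightarrow> real) \<Rightarrow> real"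
  assumes "\<And>z. \<bar>f z\<bar> \<le> C * exp (c * (\<Sum>k\<in>UNIV. \<bar>z k\<bar>))" "0 \<le> C" "0 \<le> c" "\<And>k. \<bar>a k\<bar> \<le> 1"
  shows "\<bar>f (\<lambda>k. a k * z k)\<bar> \<le> C * exp (c * (\<Sum>k\<in>UNIV. \<bar>z k\<bar>))"
proof -
  have "(\<Sum>k\<in>UNIV. \<bar>a k * z k\<bar>) \<le> (\<Sum>k\<in>UNIV. \<bar>z k\<bar>)"
    using assms(4) by (intro sum_mono) (simp add: abs_mult mult_left_le_one_le)
  then have "C * exp (c * (\<Sum>k\<in>UNIV. \<bar>a k * z k\<bar>)) \<le> C * exp (c * (\<Sum>k\<in>UNIV. \<bar>z k\<bar>))"
    using assms(2,3) by (auto intro!: mult_left_mono)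
  with assms(1)[of "\<lambda>k. a k * z k"] show ?thesis
    by linarith
qed

lemma measurable_scale [measurable]:
  "(\<lambda>z k. a k * z k) \<in> measurable (PiM UNIV (\<lambda>_::'k. borel :: real measure)) (PiM UNIV (\<lambda>_. borel))"
  using measurable_restrict[of UNIV "\<lambda>k z. a k * z k" "PiM UNIV (\<lambda>_. borel)" "\<lambda>_. borel"]
  by (simp add: restrict_def)

text \<open>
  The predicate \<open>\<sigma>\<close> selects the coordinates whose variance grows from \<open>0\<close> to \<open>1\<close> as \<open>t\<close> runs through
  \<open>[0, 1]\<close>; for the others it shrinks from \<open>1\<close> to \<open>0\<close>.
\<close>
definition weight :: "('k \<Rightarrow> bool) \<Rightarrow> real \<Rightarrow> 'k \<Rightarrow> real" where
  "weight \<sigma> t k = (if \<sigma> k then sqrt t else sqrt (1 - t))"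

definition weight_sign :: "('k \<Rightarrow> bool) \<Rightarrow> 'k \<Rightarrow> real" where
  "weight_sign \<sigma> k = (if \<sigma> k then 1 else - 1)"

lemma abs_weight_le_1: "t \<in> {0..1} \<Longrightarrow> \<bar>weight \<sigma> t k\<bar> \<le> 1"
  by (auto simp: weight_def)

text \<open>
  The derivative is written with the weight in the denominator. Integration by parts later produces
  the same weight as a factor, and the product is \<open>1/2\<close> up to sign.
\<close>
lemma weight_has_derivative:
  assumes "t \<in> {0<..<1}"
  shows "((\<lambda>t. weight \<sigma> t k) has_real_derivative weight_sign \<sigma> k / (2 * weight \<sigma> t k)) (at t)"
proof (cases "\<sigma> k")
  case True
  then show ?thesis
    using assms DERIV_real_sqrt[of t] by (simp add: weight_def weight_sign_def inverse_eq_divide mult.commute)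
next
  case False
  have "((\<lambda>t. sqrt (1 - t)) has_real_derivative inverse (sqrt (1 - t)) / 2 * (0 - 1)) (at t)"
    using assms by (intro DERIV_chain2[OF DERIV_real_sqrt] DERIV_diff DERIV_const DERIV_ident) auto
  with False show ?thesis
    by (simp add: weight_def weight_sign_def inverse_eq_divide mult.commute)
qed

lemma continuous_on_weight: "continuous_on S (\<lambda>t. weight \<sigma> t k)"
proof (cases "\<sigma> k")
  case True
  then show ?thesis
    unfolding weight_def if_P[OF True] by (intro continuous_on_real_sqrt continuous_on_id)
next
  case False
  then show ?thesis
    unfolding weight_def if_not_P[OF False]
    by (intro continuous_on_real_sqrt continuous_on_diff continuous_on_const continuous_on_id)
qed

context iid_std_normals
begin

definition path :: "('k \<Rightarrow> bool) \<Rightarrow> real \<Rightarrow> 'w \<Rightarrow> 'k \<Rightarrow> real" where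
  "path \<sigma> t \<omega> = (\<lambda>k. weight \<sigma> t k * \<gamma> k \<omega>)"

lemma measurable_path [measurable]: "path \<sigma> t \<in> measurable M (PiM UNIV (\<lambda>_. borel))"
  unfolding path_def by (rule measurable_compose[OF measurable_joint measurable_scale])

lemma path_bound:
  assumes "\<And>z. \<bar>f z\<bar> \<le> C * exp (c * (\<Sum>k\<in>UNIV. \<bar>z k\<bar>))" "0 \<le> C" "0 \<le> c" "t \<in> {0..1}"
  shows "\<bar>f (path \<sigma> t \<omega>)\<bar> \<le> C * exp (c * (\<Sum>k\<in>UNIV. \<bar>\<gamma> k \<omega>\<bar>))"
  unfolding path_def
  by (rule exp_growth_scale[of f C c "weight \<sigma> t" "\<lambda>k. \<gamma> k \<omega>"]) (use assms in \<open>simp_all add: abs_weight_le_1\<close>)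

lemma integrable_path:
  assumes "exp_growth f" "f \<in> borel_measurable (PiM UNIV (\<lambda>_. borel))" "t \<in> {0..1}"
  shows "integrable M (\<lambda>\<omega>. f (path \<sigma> t \<omega>))"
proof -
  obtain C c where C: "0 \<le> C" "0 \<le> c" "\<And>z. \<bar>f z\<bar> \<le> C * exp (c * (\<Sum>k\<in>UNIV. \<bar>z k\<bar>))"
    using assms(1) by (rule exp_growthE) blast
  show ?thesis
  proof (rule Bochner_Integration.integrable_bound)
    show "integrable M (\<lambda>\<omega>. C * exp (c * (\<Sum>k\<in>UNIV. \<bar>\<gamma> k \<omega>\<bar>)))"
      by (intro integrable_mult_right integrable_exp_sum_abs)
    show "AE \<omega> in M. norm (f (path \<sigma> t \<omega>)) \<le> norm (C * exp (c * (\<Sum>k\<in>UNIV. \<bar>\<gamma> k \<omega>\<bar>)))"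
      using path_bound[of f C c, OF C(3,1,2) assms(3)] C(1) by (simp add: abs_mult)
    show "(\<lambda>\<omega>. f (path \<sigma> t \<omega>)) \<in> borel_measurable M"
      using assms(2) by measurable
  qed
qed

text \<open>
  By the chain rule the derivative is a sum of expectations of \<open>w' k * \<gamma> k * f' k\<close>, where \<open>w'\<close> is the derivative of
  the weight. Integration by parts replaces the factor \<open>\<gamma> k\<close> by a derivative of \<open>f' k\<close> along
  coordinate \<open>k\<close>, which brings out the weight itself.
  
  The premise \<open>chain_rule\<close> expresses that \<open>f\<close> is differentiable with partial derivatives \<open>f'\<close>. It is
  stated along curves, since the function space \<open>'k \<Rightarrow> real\<close> carries no norm.
\<close>
lemma interpolation_derivative:
  fixes f :: "('k \<Rightarrow> real) \<Rightarrow> real" and f' f'' :: "'k \<Rightarrow> ('k \<Rightarrow> real) \<Rightarrow> real"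
  assumes t: "t \<in> {0<..<1}"
    and f: "exp_growth f" "f \<in> borel_measurable (PiM UNIV (\<lambda>_. borel))"
    and f': "\<And>k. exp_growth (f' k)" "\<And>k. f' k \<in> borel_measurable (PiM UNIV (\<lambda>_. borel))"
    and f'': "\<And>k. exp_growth (f'' k)" "\<And>k. f'' k \<in> borel_measurable (PiM UNIV (\<lambda>_. borel))"
    and chain_rule: "\<And>z z' t. (\<And>k. ((\<lambda>s. z s k) has_real_derivative z' k) (at t)) \<Longrightarrow>
        ((\<lambda>s. f (z s)) has_real_derivative (\<Sum>k\<in>UNIV. z' k * f' k (z t))) (at t)"
    and second: "\<And>k z y. ((\<lambda>y. f' k (z(k := y))) has_real_derivative f'' k (z(k := y))) (at y)"
    and cont: "\<And>k z. continuous_on UNIV (\<lambda>y. f'' k (z(k := y)))"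
  shows "((\<lambda>t. expectation (\<lambda>\<omega>. f (path \<sigma> t \<omega>))) has_real_derivative
    expectation (\<lambda>\<omega>. \<Sum>k\<in>UNIV. weight_sign \<sigma> k * f'' k (path \<sigma> t \<omega>)) / 2) (at t)"
proof -
  define w' where "w' t k = weight_sign \<sigma> k / (2 * weight \<sigma> t k)" for t k
  \<comment> \<open>A neighbourhood of \<open>t\<close> that stays away from \<open>0\<close> and \<open>1\<close>, where the derivative of a weight explodes.\<close>
  define S where "S = {t / 2<..<(1 + t) / 2}"
  define L where "L = 1 / sqrt (t / 2) + 1 / sqrt ((1 - t) / 2)"
  have S: "open S" "convex S" "t \<in> S" "S \<subseteq> {0<..<1}"
    unfolding S_def by (rule open_greaterThanLessThan, rule convex_real_interval) (use t in auto)
  have L: "\<bar>w' s k\<bar> \<le> L" if "s \<in> S" for s k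
  proof -
    have "0 < s" "s < 1"
      using subsetD[OF S(4) that] by simp_all
    have "1 / (2 * sqrt s) \<le> 1 / sqrt (t / 2)" "1 / (2 * sqrt (1 - s)) \<le> 1 / sqrt ((1 - t) / 2)"
    proof -
      have "sqrt (t / 2) \<le> sqrt s" "sqrt ((1 - t) / 2) \<le> sqrt (1 - s)" "0 < sqrt (t/2)" "0 < sqrt ((1 - t) / 2)"
        using that t by (auto simp: S_def)
      then show "1 / (2 * sqrt s) \<le> 1 / sqrt (t / 2)" "1 / (2 * sqrt (1 - s)) \<le> 1 / sqrt ((1 - t) / 2)"
        by (intro frac_le; linarith)+
    qed
    moreover have "0 \<le> 1 / sqrt (t / 2)" "0 \<le> 1 / sqrt ((1 - t) / 2)"
      using t by auto
    moreover have "\<bar>w' s k\<bar> = 1 / (2 * sqrt s) \<or> \<bar>w' s k\<bar> = 1 / (2 * sqrt (1 - s))"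
      using \<open>0 < s\<close> \<open>s < 1\<close> unfolding w'_def weight_def weight_sign_def by (simp add: abs_divide)
    ultimately show ?thesis
      unfolding L_def by linarith
  qed
  have "\<forall>k. \<exists>C c. 0 \<le> C \<and> 0 \<le> c \<and> (\<forall>z. \<bar>f' k z\<bar> \<le> C * exp (c * (\<Sum>k\<in>UNIV. \<bar>z k\<bar>)))"
    using f'(1) unfolding exp_growth_def by blast
  then obtain C c where *: "\<forall>k. 0 \<le> C k \<and> 0 \<le> c k \<and> (\<forall>z. \<bar>f' k z\<bar> \<le> C k * exp (c k * (\<Sum>k\<in>UNIV. \<bar>z k\<bar>)))"
    unfolding choice_iff by blast
  then have C: "0 \<le> C k" "0 \<le> c k" "\<bar>f' k z\<bar> \<le> C k * exp (c k * (\<Sum>k\<in>UNIV. \<bar>z k\<bar>))" for k z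
    by blast+
  define bound where "bound \<omega> = (\<Sum>k\<in>UNIV. L * (\<bar>\<gamma> k \<omega>\<bar> * (C k * exp (c k * (\<Sum>k\<in>UNIV. \<bar>\<gamma> k \<omega>\<bar>)))))" for \<omega>
  have "((\<lambda>t. expectation (\<lambda>\<omega>. f (path \<sigma> t \<omega>))) has_real_derivative
      expectation (\<lambda>\<omega>. \<Sum>k\<in>UNIV. w' t k * \<gamma> k \<omega> * f' k (path \<sigma> t \<omega>))) (at t)"
  proof (rule has_real_derivative_lebesgue_integral[OF S(1-3)])
    show "integrable M (\<lambda>\<omega>. f (path \<sigma> s \<omega>))" if "s \<in> S" for s
      using subsetD[OF S(4) that] f by (intro integrable_path) auto
    show "(\<lambda>\<omega>. \<Sum>k\<in>UNIV. w' t k * \<gamma> k \<omega> * f' k (path \<sigma> t \<omega>)) \<in> borel_measurable M"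
      using f'(2) by measurable
    show "((\<lambda>s. f (path \<sigma> s \<omega>)) has_real_derivative (\<Sum>k\<in>UNIV. w' s k * \<gamma> k \<omega> * f' k (path \<sigma> s \<omega>))) (at s)"
      if "s \<in> S" for s \<omega>
    proof (rule chain_rule)
      show "((\<lambda>s. path \<sigma> s \<omega> k) has_real_derivative w' s k * \<gamma> k \<omega>) (at s)" for k
        unfolding path_def w'_def
        by (intro DERIV_cmult_right weight_has_derivative subsetD[OF S(4) that])
    qed
    show "\<bar>\<Sum>k\<in>UNIV. w' s k * \<gamma> k \<omega> * f' k (path \<sigma> s \<omega>)\<bar> \<le> bound \<omega>" if "s \<in> S" for s \<omega>
    proof -
      have "\<bar>w' s k\<bar> * (\<bar>\<gamma> k \<omega>\<bar> * \<bar>f' k (path \<sigma> s \<omega>)\<bar>)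
          \<le> L * (\<bar>\<gamma> k \<omega>\<bar> * (C k * exp (c k * (\<Sum>k\<in>UNIV. \<bar>\<gamma> k \<omega>\<bar>))))" for k
      proof (intro mult_mono mult_nonneg_nonneg abs_ge_zero order_refl)
        show "\<bar>f' k (path \<sigma> s \<omega>)\<bar> \<le> C k * exp (c k * (\<Sum>k\<in>UNIV. \<bar>\<gamma> k \<omega>\<bar>))"
          using path_bound[of "f' k" "C k" "c k" s, OF C(3) C(1) C(2)] subsetD[OF S(4) that] by simp
      qed (use L[OF that, of k] in \<open>auto intro: order_trans[OF abs_ge_zero]\<close>)
      then show ?thesis
        unfolding bound_def by (intro order_trans[OF sum_abs] sum_mono) (simp add: abs_mult mult.assoc)
    qed
    show "integrable M bound"
      unfolding bound_def
    proof (intro Bochner_Integration.integrable_sum integrable_mult_right)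
      fix k
      have "exp_growth (\<lambda>z. C k * exp (c k * (\<Sum>k\<in>UNIV. \<bar>z k\<bar>)))"
        unfolding exp_growth_def using C(1,2)[of k] by (intro exI[of _ "C k"] exI[of _ "c k"]) auto
      then have "integrable M (\<lambda>\<omega>. \<gamma> k \<omega> * (C k * exp (c k * (\<Sum>k\<in>UNIV. \<bar>\<gamma> k \<omega>\<bar>))))"
        by (intro integrable_exp_growth[of "\<lambda>z. z k * (C k * exp (c k * (\<Sum>k\<in>UNIV. \<bar>z k\<bar>)))"] exp_growth_mult_coord) auto
      from integrable_norm[OF this] show "integrable M (\<lambda>\<omega>. \<bar>\<gamma> k \<omega>\<bar> * (C k * exp (c k * (\<Sum>k\<in>UNIV. \<bar>\<gamma> k \<omega>\<bar>))))"
        using C(1)[of k] by (simp add: abs_mult)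
    qed
  qed
  also have "expectation (\<lambda>\<omega>. \<Sum>k\<in>UNIV. w' t k * \<gamma> k \<omega> * f' k (path \<sigma> t \<omega>)) =
      (\<Sum>k\<in>UNIV. weight_sign \<sigma> k * expectation (\<lambda>\<omega>. f'' k (path \<sigma> t \<omega>)) / 2)"
  proof -
    have *: "integrable M (\<lambda>\<omega>. w' t k * (\<gamma> k \<omega> * f' k (path \<sigma> t \<omega>)))"
      "expectation (\<lambda>\<omega>. w' t k * (\<gamma> k \<omega> * f' k (path \<sigma> t \<omega>))) =
        weight_sign \<sigma> k * expectation (\<lambda>\<omega>. f'' k (path \<sigma> t \<omega>)) / 2" for k
    proof -
      let ?a = "weight \<sigma> t"
      have a: "\<bar>?a j\<bar> \<le> 1" "?a j \<noteq> 0" for j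
        using t abs_weight_le_1[of t] by (auto simp: weight_def)
      have growth: "exp_growth (\<lambda>z. g (\<lambda>j. ?a j * z j))" if "exp_growth g" for g :: "('k \<Rightarrow> real) \<Rightarrow> real"
      proof -
        obtain C c where C: "0 \<le> C" "0 \<le> c" "\<And>z. \<bar>g z\<bar> \<le> C * exp (c * (\<Sum>k\<in>UNIV. \<bar>z k\<bar>))"
          using \<open>exp_growth g\<close> by (rule exp_growthE) blast
        have "\<bar>g (\<lambda>j. ?a j * z j)\<bar> \<le> C * exp (c * (\<Sum>k\<in>UNIV. \<bar>z k\<bar>))" for z
          by (rule exp_growth_scale[of g C c, OF C(3,1,2) a(1)])
        with C(1,2) show ?thesis
          unfolding exp_growth_def by blast
      qed
      \<comment> \<open>Moving coordinate \<open>k\<close> by \<open>y\<close> moves the argument of \<open>f' k\<close> by \<open>?a k * y\<close>, whence the factor \<open>?a k\<close>.\<close>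
      have upd: "(\<lambda>j. ?a j * (z(k := y)) j) = (\<lambda>j. ?a j * z j)(k := ?a k * y)" for z y
        by auto
      have int: "integrable M (\<lambda>\<omega>. \<gamma> k \<omega> * f' k (path \<sigma> t \<omega>))"
        unfolding path_def
        by (rule integrable_exp_growth[of "\<lambda>z. z k * f' k (\<lambda>j. ?a j * z j)"])
           (use f' in \<open>auto intro!: exp_growth_mult_coord growth\<close>)
      then show "integrable M (\<lambda>\<omega>. w' t k * (\<gamma> k \<omega> * f' k (path \<sigma> t \<omega>)))"
        by simp
      have "expectation (\<lambda>\<omega>. \<gamma> k \<omega> * f' k (\<lambda>j. ?a j * \<gamma> j \<omega>)) = expectation (\<lambda>\<omega>. ?a k * f'' k (\<lambda>j. ?a j * \<gamma> j \<omega>))"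
      proof (rule expectation_integration_by_parts[of "\<lambda>z. f' k (\<lambda>j. ?a j * z j)" "\<lambda>z. ?a k * f'' k (\<lambda>j. ?a j * z j)"])
        show "exp_growth (\<lambda>z. ?a k * f'' k (\<lambda>j. ?a j * z j))"
        proof -
          obtain C c where C: "0 \<le> C" "0 \<le> c" "\<And>z. \<bar>f'' k (\<lambda>j. ?a j * z j)\<bar> \<le> C * exp (c * (\<Sum>k\<in>UNIV. \<bar>z k\<bar>))"
            using growth[OF f''(1)[of k]] by (rule exp_growthE) blast
          have "\<bar>?a k * f'' k (\<lambda>j. ?a j * z j)\<bar> \<le> C * exp (c * (\<Sum>k\<in>UNIV. \<bar>z k\<bar>))" for z
            using mult_left_le_one_le[OF abs_ge_zero abs_ge_zero a(1)] C(3)[of z]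
            by (metis abs_mult order_trans)
          then show ?thesis
            using C(1,2) unfolding exp_growth_def by blast
        qed
        show "((\<lambda>y. f' k (\<lambda>j. ?a j * (z(k := y)) j)) has_real_derivative
            ?a k * f'' k (\<lambda>j. ?a j * (z(k := y)) j)) (at y)" for z y
          unfolding upd
          using DERIV_chain2[OF second DERIV_cmult[OF DERIV_ident, of "?a k"], of k "\<lambda>j. ?a j * z j" y UNIV]
          by (simp add: mult.commute)
        show "continuous_on UNIV (\<lambda>y. ?a k * f'' k (\<lambda>j. ?a j * (z(k := y)) j))" for z
          unfolding upd
          by (intro continuous_intros continuous_on_compose2[OF cont[of k "\<lambda>j. ?a j * z j"]]) auto
      qed (use f' f'' in \<open>auto intro!: growth\<close>)
      then show "expectation (\<lambda>\<omega>. w' t k * (\<gamma> k \<omega> * f' k (path \<sigma> t \<omega>))) =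
        weight_sign \<sigma> k * expectation (\<lambda>\<omega>. f'' k (path \<sigma> t \<omega>)) / 2"
        using a(2)[of k] unfolding path_def w'_def by simp
    qed
    show ?thesis
      unfolding mult.assoc by (subst Bochner_Integration.integral_sum) (simp_all only: *)
  qed
  also have "\<dots> = expectation (\<lambda>\<omega>. \<Sum>k\<in>UNIV. weight_sign \<sigma> k * f'' k (path \<sigma> t \<omega>)) / 2"
    using t f'' by (subst Bochner_Integration.integral_sum) (auto simp: sum_divide_distrib intro!: integrable_path)
  finally show ?thesis .
qed

end

section \<open>Powers of sums of exponentials of smoothed norms\<close>

text \<open>
  The setting is linear algebra only: the coefficients \<open>v i k\<close> and \<open>c i k\<close> say how much of coordinate \<open>k\<close>
  enters the vector and the scalar that belong to index \<open>i\<close>.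
\<close>
locale norm_softmax =
  fixes I :: "'i set" and v :: "'i \<Rightarrow> 'k::finite \<Rightarrow> 'e::euclidean_space" and c :: "'i \<Rightarrow> 'k \<Rightarrow> real"
    and \<beta> s c3 :: real
  assumes finite_I: "finite I" and I_nonempty: "I \<noteq> {}"
    and s_sq: "s\<^sup>2 = 1" and \<beta>_nonneg: "0 \<le> \<beta>" and c3_nonneg: "0 \<le> c3"
begin

definition V :: "'i \<Rightarrow> ('k \<Rightarrow> real) \<Rightarrow> 'e" where
  "V i z = (\<Sum>k\<in>UNIV. z k *\<^sub>R v i k)"

definition W :: "'i \<Rightarrow> ('k \<Rightarrow> real) \<Rightarrow> real" where
  "W i z = (\<Sum>k\<in>UNIV. z k * c i k)"

text \<open>
  For \<open>\<epsilon> > 0\<close> this is a smooth substitute for the norm of \<open>V i z\<close>, which it equals for \<open>\<epsilon> = 0\<close>.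
\<close>
definition R :: "real \<Rightarrow> 'i \<Rightarrow> ('k \<Rightarrow> real) \<Rightarrow> real" where
  "R \<epsilon> i z = sqrt ((norm (V i z))\<^sup>2 + \<epsilon>)"

definition A :: "real \<Rightarrow> 'i \<Rightarrow> ('k \<Rightarrow> real) \<Rightarrow> real" where
  "A \<epsilon> i z = exp (\<beta> * (s * R \<epsilon> i z + W i z))"

definition Z :: "real \<Rightarrow> ('k \<Rightarrow> real) \<Rightarrow> real" where
  "Z \<epsilon> z = (\<Sum>i\<in>I. A \<epsilon> i z)"

definition F :: "real \<Rightarrow> ('k \<Rightarrow> real) \<Rightarrow> real" where
  "F \<epsilon> z = Z \<epsilon> z powr c3"

text \<open>
  The partial derivative in direction \<open>k\<close> of \<open>s * R \<epsilon> i + W i\<close>; below, \<open>q'\<close> is the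
  derivative of \<open>q\<close> in the same direction.
\<close>
definition q :: "real \<Rightarrow> 'i \<Rightarrow> 'k \<Rightarrow> ('k \<Rightarrow> real) \<Rightarrow> real" where
  "q \<epsilon> i k z = s * (V i z \<bullet> v i k) / R \<epsilon> i z + c i k"

definition q' :: "real \<Rightarrow> 'i \<Rightarrow> 'k \<Rightarrow> ('k \<Rightarrow> real) \<Rightarrow> real" where
  "q' \<epsilon> i k z = s * (v i k \<bullet> v i k / R \<epsilon> i z - (V i z \<bullet> v i k)\<^sup>2 / R \<epsilon> i z ^ 3)"

text \<open>
  The functions \<open>F'\<close> and \<open>F''\<close> are the first and the pure second partial derivative of \<open>F\<close> in direction
  \<open>k\<close>, as shown in \<open>F_chain_rule\<close> and \<open>F'_has_derivative\<close>.
\<close>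
definition F' :: "real \<Rightarrow> 'k \<Rightarrow> ('k \<Rightarrow> real) \<Rightarrow> real" where
  "F' \<epsilon> k z = c3 * \<beta> * (Z \<epsilon> z powr (c3 - 1) * (\<Sum>i\<in>I. A \<epsilon> i z * q \<epsilon> i k z))"

definition F'' :: "real \<Rightarrow> 'k \<Rightarrow> ('k \<Rightarrow> real) \<Rightarrow> real" where
  "F'' \<epsilon> k z =
    c3 * (c3 - 1) * \<beta>\<^sup>2 * (Z \<epsilon> z powr (c3 - 2) * (\<Sum>i\<in>I. A \<epsilon> i z * q \<epsilon> i k z)\<^sup>2)
    + c3 * \<beta> * (Z \<epsilon> z powr (c3 - 1) * (\<Sum>i\<in>I. A \<epsilon> i z * (\<beta> * (q \<epsilon> i k z)\<^sup>2 + q' \<epsilon> i k z)))"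

text \<open>
  What is left of the signed sum of the \<open>F''\<close>. It contains only first derivatives of the smoothed
  norms and so stays bounded by a multiple of \<open>F\<close> as \<open>\<epsilon>\<close> tends to \<open>0\<close>. At \<open>\<epsilon> = 0\<close> the quotient is the cosine of the angle
  between the two vectors.
\<close>
definition kernel :: "('i \<Rightarrow> 'i \<Rightarrow> real) \<Rightarrow> real \<Rightarrow> 'i \<Rightarrow> 'i \<Rightarrow> ('k \<Rightarrow> real) \<Rightarrow> real" where
  "kernel D \<epsilon> i p z = A \<epsilon> i z * A \<epsilon> p z / Z \<epsilon> z powr (2 - c3) * D i p
    * (1 - (V i z \<bullet> V p z) / (R \<epsilon> i z * R \<epsilon> p z))"

lemma A_pos: "0 < A \<epsilon> i z"
  by (simp add: A_def)

lemma A_le_Z: "i \<in> I \<Longrightarrow> A \<epsilon> i z \<le> Z \<epsilon> z"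
  unfolding Z_def using finite_I A_pos by (intro member_le_sum) (auto intro: less_imp_le)

lemma Z_pos: "0 < Z \<epsilon> z"
  unfolding Z_def using finite_I I_nonempty A_pos by (intro sum_pos) auto

lemma norm_V_le_R: "0 \<le> \<epsilon> \<Longrightarrow> norm (V i z) \<le> R \<epsilon> i z"
  unfolding R_def by (rule real_le_rsqrt) simp

lemma sqrt_le_R: "0 \<le> \<epsilon> \<Longrightarrow> sqrt \<epsilon> \<le> R \<epsilon> i z"
  unfolding R_def by simp

lemma R_pos: "0 < \<epsilon> \<Longrightarrow> 0 < R \<epsilon> i z"
  using sqrt_le_R[of \<epsilon> i z] real_sqrt_gt_zero[of \<epsilon>] by linarith

lemma R_0: "R 0 i z = norm (V i z)"
  by (simp add: R_def)

lemma abs_s: "\<bar>s\<bar> = 1"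
  using s_sq by (metis abs_1 power2_eq_iff abs_if abs_minus one_power2)

lemma measurable_V [measurable]: "V i \<in> borel_measurable (PiM UNIV (\<lambda>_. borel))"
  unfolding V_def by measurable

lemma measurable_W [measurable]: "W i \<in> borel_measurable (PiM UNIV (\<lambda>_. borel))"
  unfolding W_def by measurable

lemma measurable_R [measurable]: "R \<epsilon> i \<in> borel_measurable (PiM UNIV (\<lambda>_. borel))"
  unfolding R_def by measurable

lemma measurable_A [measurable]: "A \<epsilon> i \<in> borel_measurable (PiM UNIV (\<lambda>_. borel))"
  unfolding A_def by measurable

lemma measurable_Z [measurable]: "Z \<epsilon> \<in> borel_measurable (PiM UNIV (\<lambda>_. borel))"
  unfolding Z_def by measurable

lemma measurable_q [measurable]:
  "q \<epsilon> i k \<in> borel_measurable (PiM UNIV (\<lambda>_. borel))" "q' \<epsilon> i k \<in> borel_measurable (PiM UNIV (\<lambda>_. borel))"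
  unfolding q_def q'_def by measurable

lemma measurable_F [measurable]:
  "F \<epsilon> \<in> borel_measurable (PiM UNIV (\<lambda>_. borel))"
  "F' \<epsilon> k \<in> borel_measurable (PiM UNIV (\<lambda>_. borel))"
  "F'' \<epsilon> k \<in> borel_measurable (PiM UNIV (\<lambda>_. borel))"
  unfolding F_def F'_def F''_def by measurable

lemma measurable_kernel [measurable]: "kernel D \<epsilon> i p \<in> borel_measurable (PiM UNIV (\<lambda>_. borel))"
  unfolding kernel_def by measurable

section \<open>Continuity in the smoothing parameter and the Gaussians\<close>

text \<open>
  The smoothing parameter and the point vary together along an arbitrary filter. One set of limits
  thereby serves continuity in time, continuity along coordinate lines, and the limit \<open>\<epsilon> = 0\<close>.
\<close>
context
  fixes \<epsilon> :: "'x \<Rightarrow> real" and e and z :: "'x \<Rightarrow> 'k \<Rightarrow> real" and a and Fil :: "'x filter"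
  assumes \<epsilon>: "(\<epsilon> \<longlongrightarrow> e) Fil" and z: "\<And>k. ((\<lambda>x. z x k) \<longlongrightarrow> a k) Fil"
begin

lemma tendsto_V: "((\<lambda>x. V i (z x)) \<longlongrightarrow> V i a) Fil"
  unfolding V_def by (intro tendsto_intros z)

lemma tendsto_W: "((\<lambda>x. W i (z x)) \<longlongrightarrow> W i a) Fil"
  unfolding W_def by (intro tendsto_intros z)

lemma tendsto_R: "((\<lambda>x. R (\<epsilon> x) i (z x)) \<longlongrightarrow> R e i a) Fil"
  unfolding R_def by (intro tendsto_intros \<epsilon> tendsto_V)

lemma tendsto_A: "((\<lambda>x. A (\<epsilon> x) i (z x)) \<longlongrightarrow> A e i a) Fil"
  unfolding A_def by (intro tendsto_intros tendsto_R tendsto_W)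

lemma tendsto_Z: "((\<lambda>x. Z (\<epsilon> x) (z x)) \<longlongrightarrow> Z e a) Fil"
  unfolding Z_def by (intro tendsto_intros tendsto_A)

lemma tendsto_F: "((\<lambda>x. F (\<epsilon> x) (z x)) \<longlongrightarrow> F e a) Fil"
  unfolding F_def using Z_pos[of e a] by (intro tendsto_powr tendsto_Z tendsto_const) auto

lemma tendsto_F'':
  assumes "0 < e"
  shows "((\<lambda>x. F'' (\<epsilon> x) k (z x)) \<longlongrightarrow> F'' e k a) Fil"
proof -
  have "R e i a \<noteq> 0" for i
    using R_pos[OF assms, of i a] by simp
  then have "((\<lambda>x. q (\<epsilon> x) i k (z x)) \<longlongrightarrow> q e i k a) Fil" "((\<lambda>x. q' (\<epsilon> x) i k (z x)) \<longlongrightarrow> q' e i k a) Fil" for i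
    unfolding q_def q'_def by (intro tendsto_intros tendsto_R tendsto_V; simp)+
  then show ?thesis
    unfolding F''_def using Z_pos[of e a]
    by (intro tendsto_add tendsto_mult tendsto_powr tendsto_sum tendsto_power tendsto_Z tendsto_A tendsto_const) auto
qed

lemma tendsto_kernel:
  assumes "D i p \<noteq> 0 \<Longrightarrow> R e i a \<noteq> 0 \<and> R e p a \<noteq> 0"
  shows "((\<lambda>x. kernel D (\<epsilon> x) i p (z x)) \<longlongrightarrow> kernel D e i p a) Fil"
proof (cases "D i p = 0")
  case True
  then show ?thesis
    by (simp add: kernel_def)
next
  case False
  with assms have "R e i a * R e p a \<noteq> 0"
    by simp
  then show ?thesis
    unfolding kernel_def using Z_pos[of e a]
    by (intro tendsto_mult tendsto_divide tendsto_diff tendsto_inner tendsto_powr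
        tendsto_Z tendsto_A tendsto_R tendsto_V tendsto_const) auto
qed

end

section \<open>Partial derivatives of the smoothed functional\<close>

context
  fixes \<epsilon> :: real and z :: "real \<Rightarrow> 'k \<Rightarrow> real" and z' :: "'k \<Rightarrow> real" and t :: real
  assumes \<epsilon>: "0 < \<epsilon>" and z: "\<And>k. ((\<lambda>x. z x k) has_real_derivative z' k) (at t)"
begin

lemma V_has_derivative: "((\<lambda>x. V i (z x)) has_vector_derivative V i z') (at t)"
proof -
  have "((\<lambda>x. z x k *\<^sub>R v i k) has_vector_derivative z' k *\<^sub>R v i k) (at t)" for k
    using has_vector_derivative_scaleR[OF z has_vector_derivative_const, of k "v i k"] by simp
  then show ?thesis
    unfolding V_def by (rule has_vector_derivative_sum)
qed

lemma W_has_derivative: "((\<lambda>x. W i (z x)) has_real_derivative W i z') (at t)"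
  unfolding W_def by (intro DERIV_sum DERIV_cmult_right z)

lemma R_has_derivative:
  "((\<lambda>x. R \<epsilon> i (z x)) has_real_derivative (V i (z t) \<bullet> V i z') / R \<epsilon> i (z t)) (at t)"
proof -
  have "((\<lambda>x. V i (z x) \<bullet> V i (z x)) has_real_derivative 2 * (V i (z t) \<bullet> V i z')) (at t)"
    using has_derivative_inner[OF V_has_derivative[of i, unfolded has_vector_derivative_def]
        V_has_derivative[of i, unfolded has_vector_derivative_def]]
    unfolding has_field_derivative_def
    by (rule has_derivative_eq_rhs) (auto simp: inner_commute)
  then have deriv: "((\<lambda>x. (norm (V i (z x)))\<^sup>2 + \<epsilon>) has_real_derivative 2 * (V i (z t) \<bullet> V i z')) (at t)"
    unfolding power2_norm_eq_inner by (rule DERIV_add[THEN DERIV_cong, OF _ DERIV_const]) simp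
  have "0 < (norm (V i (z t)))\<^sup>2 + \<epsilon>"
    using \<epsilon> by (simp add: add_nonneg_pos)
  with DERIV_chain2[OF DERIV_real_sqrt deriv] show ?thesis
    unfolding R_def by (auto elim!: DERIV_cong simp: field_simps)
qed

lemma A_has_derivative:
  "((\<lambda>x. A \<epsilon> i (z x)) has_real_derivative
     A \<epsilon> i (z t) * (\<beta> * (\<Sum>k\<in>UNIV. z' k * q \<epsilon> i k (z t)))) (at t)"
proof -
  have "s * ((V i (z t) \<bullet> V i z') / R \<epsilon> i (z t)) + W i z' = (\<Sum>k\<in>UNIV. z' k * q \<epsilon> i k (z t))"
    unfolding q_def V_def[of i z'] W_def
    by (simp add: inner_sum_right sum_divide_distrib sum_distrib_left sum.distrib algebra_simps)
  with DERIV_chain2[OF DERIV_exp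
      DERIV_cmult[OF DERIV_add[OF DERIV_cmult[OF R_has_derivative] W_has_derivative]], of \<beta> s i i]
  show ?thesis
    unfolding A_def by simp
qed

lemma Z_has_derivative:
  "((\<lambda>x. Z \<epsilon> (z x)) has_real_derivative
     \<beta> * (\<Sum>k\<in>UNIV. z' k * (\<Sum>i\<in>I. A \<epsilon> i (z t) * q \<epsilon> i k (z t)))) (at t)"
proof -
  have "(\<Sum>i\<in>I. A \<epsilon> i (z t) * (\<beta> * (\<Sum>k\<in>UNIV. z' k * q \<epsilon> i k (z t)))) =
      \<beta> * (\<Sum>k\<in>UNIV. z' k * (\<Sum>i\<in>I. A \<epsilon> i (z t) * q \<epsilon> i k (z t)))"
    unfolding sum_distrib_left by (subst sum.swap) (simp add: mult_ac)
  then show ?thesis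
    unfolding Z_def by (intro DERIV_cong[OF DERIV_sum[OF A_has_derivative]])
qed

lemma Z_powr_has_derivative:
  "((\<lambda>x. Z \<epsilon> (z x) powr r) has_real_derivative r * Z \<epsilon> (z t) powr (r - 1) *
     (\<beta> * (\<Sum>k\<in>UNIV. z' k * (\<Sum>i\<in>I. A \<epsilon> i (z t) * q \<epsilon> i k (z t))))) (at t)"
  using has_real_derivative_powr[OF Z_pos] Z_has_derivative by (rule DERIV_chain2)

lemma F_chain_rule: "((\<lambda>x. F \<epsilon> (z x)) has_real_derivative (\<Sum>k\<in>UNIV. z' k * F' \<epsilon> k (z t))) (at t)"
  unfolding F_def
  by (rule DERIV_cong[OF Z_powr_has_derivative]) (simp add: F'_def sum_distrib_left mult_ac)

lemma q_has_derivative: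
  "((\<lambda>x. q \<epsilon> i k (z x)) has_real_derivative
     s * ((V i z' \<bullet> v i k) / R \<epsilon> i (z t) - (V i (z t) \<bullet> v i k) * (V i (z t) \<bullet> V i z') / R \<epsilon> i (z t) ^ 3)) (at t)"
proof -
  have "((\<lambda>x. V i (z x) \<bullet> v i k) has_real_derivative V i z' \<bullet> v i k) (at t)"
    using has_derivative_inner_left[OF V_has_derivative[of i, unfolded has_vector_derivative_def], of "v i k"]
    unfolding has_field_derivative_def by (rule has_derivative_eq_rhs) auto
  from DERIV_divide[OF DERIV_cmult[OF this, of s] R_has_derivative[of i]] show ?thesis
    unfolding q_def using R_pos[OF \<epsilon>, of i "z t"]
    by (intro DERIV_add[THEN DERIV_cong, OF _ DERIV_const])
       (auto elim!: DERIV_cong simp: field_simps power3_eq_cube power2_eq_square)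
qed

end

text \<open>
  The curve that moves coordinate \<open>k\<close> alone has derivative \<open>e\<close>, the unit vector in direction \<open>k\<close>. The
  chain rules above, applied to this curve, produce the partial derivative.
\<close>
lemma F'_has_derivative:
  assumes "0 < \<epsilon>"
  shows "((\<lambda>y. F' \<epsilon> k (z(k := y))) has_real_derivative F'' \<epsilon> k (z(k := y))) (at y)"
proof -
  define e :: "'k \<Rightarrow> real" where "e = (\<lambda>j. if j = k then 1 else 0)"
  have line: "((\<lambda>x. (z(k := x)) j) has_real_derivative e j) (at y)" for j
    by (cases "j = k") (simp_all add: e_def)
  have V_e: "V i e = v i k" for i
    by (simp add: V_def e_def if_distrib[of "\<lambda>r. r *\<^sub>R _"] cong: if_cong)
  have sum_e: "(\<Sum>j\<in>UNIV. e j * g j) = g k" for g :: "'k \<Rightarrow> real"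
    by (simp add: e_def if_distrib[of "\<lambda>r. r * _"] cong: if_cong)
  note A = A_has_derivative[where z = "\<lambda>x. z(k := x)", OF assms line, unfolded sum_e]
  note Z = Z_powr_has_derivative[where z = "\<lambda>x. z(k := x)" and r = "c3 - 1", OF assms line, unfolded sum_e]
  have q: "((\<lambda>x. q \<epsilon> i k (z(k := x))) has_real_derivative q' \<epsilon> i k (z(k := y))) (at y)" for i
    using q_has_derivative[where z = "\<lambda>x. z(k := x)" and i = i and k = k, OF assms line]
    unfolding V_e q'_def by (simp add: power2_eq_square)
  have "((\<lambda>x. \<Sum>i\<in>I. A \<epsilon> i (z(k := x)) * q \<epsilon> i k (z(k := x))) has_real_derivative
    (\<Sum>i\<in>I. A \<epsilon> i (z(k := y)) * (\<beta> * (q \<epsilon> i k (z(k := y)))\<^sup>2 + q' \<epsilon> i k (z(k := y))))) (at y)"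
    by (intro DERIV_cong[OF DERIV_sum[OF DERIV_mult[OF A q]]] sum.cong)
       (simp_all add: power2_eq_square algebra_simps)
  from DERIV_cmult[OF DERIV_mult[OF Z this], of "c3 * \<beta>"] show ?thesis
    unfolding F'_def F''_def
    by (elim DERIV_cong) (simp add: power2_eq_square algebra_simps)
qed

section \<open>Growth bounds\<close>

text \<open>
  A single bound for all coefficients. A crude one suffices, because the Gaussians have exponential
  moments of every order.
\<close>
definition L :: real where
  "L = (\<Sum>i\<in>I. \<Sum>k\<in>UNIV. norm (v i k) + \<bar>c i k\<bar>)"

lemma L_nonneg: "0 \<le> L"
  unfolding L_def by (intro sum_nonneg) auto

lemma coefficient_le_L:
  assumes "i \<in> I"
  shows "norm (v i k) + \<bar>c i k\<bar> \<le> L"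
proof -
  have "norm (v i k) + \<bar>c i k\<bar> \<le> (\<Sum>k\<in>UNIV. norm (v i k) + \<bar>c i k\<bar>)"
    by (rule member_le_sum) auto
  also have "\<dots> \<le> L"
    unfolding L_def using assms finite_I
    by (intro member_le_sum[of i I "\<lambda>i. \<Sum>k\<in>UNIV. norm (v i k) + \<bar>c i k\<bar>"] sum_nonneg) auto
  finally show ?thesis .
qed

lemma norm_V_le:
  assumes "i \<in> I"
  shows "norm (V i z) \<le> L * (\<Sum>k\<in>UNIV. \<bar>z k\<bar>)" "\<bar>W i z\<bar> \<le> L * (\<Sum>k\<in>UNIV. \<bar>z k\<bar>)"
proof -
  have "norm (v i k) \<le> L" "\<bar>c i k\<bar> \<le> L" for k
    using coefficient_le_L[OF assms, of k] norm_ge_zero[of "v i k"] by linarith+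
  then have "norm (z k *\<^sub>R v i k) \<le> L * \<bar>z k\<bar>" "\<bar>z k * c i k\<bar> \<le> L * \<bar>z k\<bar>" for k
    by (simp_all add: abs_mult mult.commute[of L] mult_left_mono)
  then show "norm (V i z) \<le> L * (\<Sum>k\<in>UNIV. \<bar>z k\<bar>)" "\<bar>W i z\<bar> \<le> L * (\<Sum>k\<in>UNIV. \<bar>z k\<bar>)"
    unfolding V_def W_def sum_distrib_left
    by (auto intro!: order_trans[OF norm_sum] order_trans[OF sum_abs] sum_mono)
qed

definition C_F :: real where "C_F = (real (card I) * exp \<beta>) powr c3"
definition c_F :: real where "c_F = 2 * \<beta> * L * c3"

lemma growth_constants_nonneg: "0 \<le> C_F" "0 \<le> c_F"
  using L_nonneg \<beta>_nonneg c3_nonneg by (simp_all add: C_F_def c_F_def)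

lemma F_pos: "0 < F \<epsilon> z"
  unfolding F_def using Z_pos[of \<epsilon> z] by simp

text \<open>
  The constants are the same for all \<open>\<epsilon>\<close> in \<open>[0, 1]\<close>, which makes dominated convergence possible when the smoothing is
  removed. Each exponent is at most \<open>\<beta> * (1 + 2 * L * S)\<close> for \<open>S\<close> the sum of the \<open>\<bar>z k\<bar>\<close>: the norm and the
  scalar contribute \<open>L * S\<close> each, the smoothing at most \<open>sqrt \<epsilon> \<le> 1\<close>.
\<close>
lemma F_bound:
  assumes "\<epsilon> \<in> {0..1}"
  shows "F \<epsilon> z \<le> C_F * exp (c_F * (\<Sum>k\<in>UNIV. \<bar>z k\<bar>))"
proof -
  let ?S = "\<Sum>k\<in>UNIV. \<bar>z k\<bar>"
  have "A \<epsilon> i z \<le> exp (\<beta> * (1 + 2 * L * ?S))" if "i \<in> I" for i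
  proof -
    have "R \<epsilon> i z \<le> norm (V i z) + sqrt \<epsilon>"
      using sqrt_add_le_add_sqrt[of "(norm (V i z))\<^sup>2" \<epsilon>] assms by (simp add: R_def)
    also have "\<dots> \<le> L * ?S + 1"
      using norm_V_le(1)[OF that, of z] assms by (intro add_mono) auto
    finally have "\<bar>s * R \<epsilon> i z\<bar> \<le> L * ?S + 1"
      using assms by (simp add: abs_mult abs_s R_def)
    then have "s * R \<epsilon> i z + W i z \<le> 1 + 2 * L * ?S"
      using norm_V_le(2)[OF that, of z] by linarith
    then show ?thesis
      unfolding A_def using \<beta>_nonneg by (simp add: mult_left_mono)
  qed
  then have "Z \<epsilon> z \<le> real (card I) * exp (\<beta> * (1 + 2 * L * ?S))"
    unfolding Z_def by (rule sum_bounded_above)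
  then have "F \<epsilon> z \<le> (real (card I) * exp (\<beta> * (1 + 2 * L * ?S))) powr c3"
    unfolding F_def using c3_nonneg Z_pos[of \<epsilon> z] by (intro powr_mono2) auto
  also have "real (card I) * exp (\<beta> * (1 + 2 * L * ?S)) = (real (card I) * exp \<beta>) * exp (2 * \<beta> * L * ?S)"
    by (simp add: distrib_left exp_add mult_ac)
  also have "\<dots> powr c3 = C_F * exp (c_F * ?S)"
    unfolding C_F_def c_F_def by (simp add: powr_mult exp_powr_real mult_ac)
  finally show ?thesis .
qed

lemma sum_A_le:
  assumes "\<And>i. i \<in> I \<Longrightarrow> \<bar>g i\<bar> \<le> B"
  shows "\<bar>\<Sum>i\<in>I. A \<epsilon> i z * g i\<bar> \<le> B * Z \<epsilon> z"
proof -
  have "\<bar>\<Sum>i\<in>I. A \<epsilon> i z * g i\<bar> \<le> (\<Sum>i\<in>I. A \<epsilon> i z * B)"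
    using assms A_pos by (intro order_trans[OF sum_abs] sum_mono) (simp add: abs_mult mult_left_mono less_imp_le)
  then show ?thesis
    by (simp add: Z_def sum_distrib_left mult.commute)
qed

text \<open>
  The second bound deteriorates as \<open>\<epsilon>\<close> tends to \<open>0\<close>: it reflects the curvature of the norm near the
  origin. It is used for fixed \<open>\<epsilon>\<close> only.
\<close>
lemma q_bound:
  assumes "0 < \<epsilon>" "i \<in> I"
  shows "\<bar>q \<epsilon> i k z\<bar> \<le> L" "\<bar>q' \<epsilon> i k z\<bar> \<le> 2 * L\<^sup>2 / sqrt \<epsilon>"
proof -
  have R: "0 < R \<epsilon> i z" "norm (V i z) \<le> R \<epsilon> i z" "sqrt \<epsilon> \<le> R \<epsilon> i z"
    using R_pos assms norm_V_le_R sqrt_le_R by auto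
  have Vv: "\<bar>V i z \<bullet> v i k\<bar> \<le> R \<epsilon> i z * norm (v i k)"
    using Cauchy_Schwarz_ineq2[of "V i z" "v i k"] R(2) by (meson mult_right_mono norm_ge_zero order_trans)
  have v: "norm (v i k) \<le> L"
    using coefficient_le_L[OF assms(2), of k] by linarith
  have "\<bar>s * (V i z \<bullet> v i k) / R \<epsilon> i z\<bar> \<le> norm (v i k)"
    using Vv R(1) by (simp add: abs_mult abs_s abs_divide field_simps)
  then show "\<bar>q \<epsilon> i k z\<bar> \<le> L"
    unfolding q_def using coefficient_le_L[OF assms(2), of k] by linarith
  have "(V i z \<bullet> v i k)\<^sup>2 \<le> (R \<epsilon> i z * norm (v i k))\<^sup>2"
    using Vv by (metis abs_ge_zero power2_abs power_mono)
  then have "(V i z \<bullet> v i k)\<^sup>2 / R \<epsilon> i z ^ 3 \<le> (R \<epsilon> i z * norm (v i k))\<^sup>2 / R \<epsilon> i z ^ 3"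
    using R(1) by (intro divide_right_mono) auto
  also have "\<dots> = (norm (v i k))\<^sup>2 / R \<epsilon> i z"
    using R(1) by (simp add: power_mult_distrib power2_eq_square power3_eq_cube)
  finally have "(V i z \<bullet> v i k)\<^sup>2 / R \<epsilon> i z ^ 3 \<le> (norm (v i k))\<^sup>2 / R \<epsilon> i z" .
  moreover have "(norm (v i k))\<^sup>2 / R \<epsilon> i z \<le> L\<^sup>2 / sqrt \<epsilon>"
    using v R assms L_nonneg by (intro frac_le power_mono) auto
  moreover have "0 \<le> (V i z \<bullet> v i k)\<^sup>2 / R \<epsilon> i z ^ 3" "0 \<le> (norm (v i k))\<^sup>2 / R \<epsilon> i z"
    using R(1) by simp_all
  ultimately have "\<bar>(norm (v i k))\<^sup>2 / R \<epsilon> i z - (V i z \<bullet> v i k)\<^sup>2 / R \<epsilon> i z ^ 3\<bar> \<le> 2 * (L\<^sup>2 / sqrt \<epsilon>)"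
    by linarith
  then show "\<bar>q' \<epsilon> i k z\<bar> \<le> 2 * L\<^sup>2 / sqrt \<epsilon>"
    unfolding q'_def abs_mult abs_s by (simp add: power2_norm_eq_inner)
qed

text \<open>
  All derivatives of \<open>F\<close> are controlled by \<open>F\<close> itself: each factor \<open>A\<close> in a numerator is at most \<open>Z\<close> and
  makes up for one negative power of \<open>Z\<close>.
\<close>
lemma F_growth:
  assumes "\<epsilon> \<in> {0..1}" "\<And>z. \<bar>f z\<bar> \<le> K * F \<epsilon> z" "0 \<le> K"
  shows "exp_growth f"
proof -
  have "\<bar>f z\<bar> \<le> (K * C_F) * exp (c_F * (\<Sum>k\<in>UNIV. \<bar>z k\<bar>))" for z
    using assms(2)[of z] mult_left_mono[OF F_bound[OF assms(1)] assms(3), of z] by (simp add: mult.assoc)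
  then show ?thesis
    unfolding exp_growth_def using growth_constants_nonneg assms(3)
    by (intro exI[of _ "K * C_F"] exI[of _ c_F]) auto
qed

lemma F_exp_growth: "\<epsilon> \<in> {0..1} \<Longrightarrow> exp_growth (F \<epsilon>)"
  using F_pos by (intro F_growth[of \<epsilon> _ 1]) (auto simp: less_imp_le)

lemma F'_exp_growth:
  assumes "\<epsilon> \<in> {0<..1}"
  shows "exp_growth (F' \<epsilon> k)"
proof (rule F_growth)
  fix z
  have "\<bar>F' \<epsilon> k z\<bar> \<le> c3 * \<beta> * (Z \<epsilon> z powr (c3 - 1) * (L * Z \<epsilon> z))"
    unfolding F'_def abs_mult using q_bound(1) assms c3_nonneg \<beta>_nonneg
    by (auto intro!: mult_left_mono sum_A_le)
  also have "\<dots> = c3 * \<beta> * L * F \<epsilon> z"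
    using Z_pos[of \<epsilon> z] by (simp add: F_def powr_diff)
  finally show "\<bar>F' \<epsilon> k z\<bar> \<le> c3 * \<beta> * L * F \<epsilon> z" .
qed (use assms c3_nonneg \<beta>_nonneg L_nonneg in auto)

lemma F''_exp_growth:
  assumes "\<epsilon> \<in> {0<..1}"
  shows "exp_growth (F'' \<epsilon> k)"
proof (rule F_growth)
  fix z
  let ?B = "\<beta> * L\<^sup>2 + 2 * L\<^sup>2 / sqrt \<epsilon>"
  have q: "\<bar>q \<epsilon> i k z\<bar> \<le> L" "\<bar>q' \<epsilon> i k z\<bar> \<le> 2 * L\<^sup>2 / sqrt \<epsilon>" if "i \<in> I" for i
    using q_bound that assms by auto
  have "\<bar>\<Sum>i\<in>I. A \<epsilon> i z * q \<epsilon> i k z\<bar> \<le> \<bar>L * Z \<epsilon> z\<bar>"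
    using sum_A_le[of "\<lambda>i. q \<epsilon> i k z" L \<epsilon> z] q(1) by auto
  then have 1: "(\<Sum>i\<in>I. A \<epsilon> i z * q \<epsilon> i k z)\<^sup>2 \<le> (L * Z \<epsilon> z)\<^sup>2"
    by (simp only: abs_le_square_iff)
  have 2: "\<bar>\<Sum>i\<in>I. A \<epsilon> i z * (\<beta> * (q \<epsilon> i k z)\<^sup>2 + q' \<epsilon> i k z)\<bar> \<le> ?B * Z \<epsilon> z"
  proof (rule sum_A_le)
    fix i assume "i \<in> I"
    have "(q \<epsilon> i k z)\<^sup>2 \<le> L\<^sup>2"
      using q(1)[OF \<open>i \<in> I\<close>] by (metis abs_ge_zero power2_abs power_mono)
    then have "\<bar>\<beta> * (q \<epsilon> i k z)\<^sup>2\<bar> \<le> \<beta> * L\<^sup>2"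
      using \<beta>_nonneg by (simp add: abs_mult mult_left_mono)
    then show "\<bar>\<beta> * (q \<epsilon> i k z)\<^sup>2 + q' \<epsilon> i k z\<bar> \<le> ?B"
      using q(2)[OF \<open>i \<in> I\<close>] by linarith
  qed
  have "\<bar>F'' \<epsilon> k z\<bar> \<le> c3 * \<bar>c3 - 1\<bar> * \<beta>\<^sup>2 * (Z \<epsilon> z powr (c3 - 2) * (L * Z \<epsilon> z)\<^sup>2)
      + c3 * \<beta> * (Z \<epsilon> z powr (c3 - 1) * (?B * Z \<epsilon> z))"
    unfolding F''_def
  proof (intro order_trans[OF abs_triangle_ineq] add_mono)
    show "\<bar>c3 * (c3 - 1) * \<beta>\<^sup>2 * (Z \<epsilon> z powr (c3 - 2) * (\<Sum>i\<in>I. A \<epsilon> i z * q \<epsilon> i k z)\<^sup>2)\<bar>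
        \<le> c3 * \<bar>c3 - 1\<bar> * \<beta>\<^sup>2 * (Z \<epsilon> z powr (c3 - 2) * (L * Z \<epsilon> z)\<^sup>2)"
      using c3_nonneg 1 by (simp add: abs_mult mult_left_mono)
    show "\<bar>c3 * \<beta> * (Z \<epsilon> z powr (c3 - 1) * (\<Sum>i\<in>I. A \<epsilon> i z * (\<beta> * (q \<epsilon> i k z)\<^sup>2 + q' \<epsilon> i k z)))\<bar>
        \<le> c3 * \<beta> * (Z \<epsilon> z powr (c3 - 1) * (?B * Z \<epsilon> z))"
      using c3_nonneg \<beta>_nonneg 2 by (simp add: abs_mult mult_left_mono)
  qed
  also have "\<dots> = (c3 * \<bar>c3 - 1\<bar> * \<beta>\<^sup>2 * L\<^sup>2 + c3 * \<beta> * ?B) * F \<epsilon> z"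
  proof -
    have "Z \<epsilon> z powr (c3 - 2) * (Z \<epsilon> z)\<^sup>2 = F \<epsilon> z" "Z \<epsilon> z powr (c3 - 1) * Z \<epsilon> z = F \<epsilon> z"
      using Z_pos[of \<epsilon> z] by (simp_all add: F_def powr_diff)
    then have "c * (Z \<epsilon> z powr (c3 - 2) * (L * Z \<epsilon> z)\<^sup>2) + d * (Z \<epsilon> z powr (c3 - 1) * (B * Z \<epsilon> z))
        = (c * L\<^sup>2 + d * B) * F \<epsilon> z" for c d B
      by (simp add: power_mult_distrib algebra_simps)
    then show ?thesis .
  qed
  finally show "\<bar>F'' \<epsilon> k z\<bar> \<le> (c3 * \<bar>c3 - 1\<bar> * \<beta>\<^sup>2 * L\<^sup>2 + c3 * \<beta> * ?B) * F \<epsilon> z" .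
qed (use assms c3_nonneg \<beta>_nonneg in auto)

text \<open>
  The factor \<open>2\<close> bounds one minus a cosine, and \<open>A i * A p \<le> Z\<^sup>2\<close> turns the quotient into \<open>Z powr c3\<close>.
\<close>
lemma kernel_bound:
  assumes "0 \<le> \<epsilon>" "i \<in> I" "p \<in> I"
  shows "\<bar>kernel D \<epsilon> i p z\<bar> \<le> 2 * \<bar>D i p\<bar> * F \<epsilon> z"
proof -
  have "\<bar>V i z \<bullet> V p z\<bar> \<le> R \<epsilon> i z * R \<epsilon> p z"
    using Cauchy_Schwarz_ineq2[of "V i z" "V p z"] norm_V_le_R[OF assms(1)]
    by (meson mult_mono norm_ge_zero order_trans)
  moreover have ratio: "\<bar>a / b\<bar> \<le> 1" if "\<bar>a\<bar> \<le> b" for a b :: real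
    using that by (cases "b = 0") (auto simp: abs_divide)
  ultimately have "\<bar>(V i z \<bullet> V p z) / (R \<epsilon> i z * R \<epsilon> p z)\<bar> \<le> 1"
    using ratio by blast
  then have 1: "\<bar>1 - (V i z \<bullet> V p z) / (R \<epsilon> i z * R \<epsilon> p z)\<bar> \<le> 2"
    by linarith
  have "A \<epsilon> i z * A \<epsilon> p z \<le> Z \<epsilon> z * Z \<epsilon> z"
    using A_le_Z assms(2,3) A_pos Z_pos by (intro mult_mono) (auto intro: less_imp_le)
  then have "A \<epsilon> i z * A \<epsilon> p z / Z \<epsilon> z powr (2 - c3) \<le> Z \<epsilon> z * Z \<epsilon> z / Z \<epsilon> z powr (2 - c3)"
    by (intro divide_right_mono) auto
  also have "\<dots> = F \<epsilon> z"
    using Z_pos[of \<epsilon> z] by (simp add: F_def powr_diff power2_eq_square)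
  finally have "\<bar>A \<epsilon> i z * A \<epsilon> p z / Z \<epsilon> z powr (2 - c3)\<bar> \<le> F \<epsilon> z"
    using A_pos by (simp add: less_imp_le abs_mult)
  then have "\<bar>A \<epsilon> i z * A \<epsilon> p z / Z \<epsilon> z powr (2 - c3)\<bar> * \<bar>D i p\<bar> * \<bar>1 - (V i z \<bullet> V p z) / (R \<epsilon> i z * R \<epsilon> p z)\<bar>
      \<le> F \<epsilon> z * \<bar>D i p\<bar> * 2"
    using 1 F_pos[of \<epsilon> z] by (intro mult_mono) auto
  then show ?thesis
    unfolding kernel_def abs_mult by (simp add: mult_ac)
qed

lemma kernel_exp_growth: "\<epsilon> \<in> {0..1} \<Longrightarrow> i \<in> I \<Longrightarrow> p \<in> I \<Longrightarrow> exp_growth (kernel D \<epsilon> i p)"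
  by (rule F_growth[of \<epsilon> _ "2 * \<bar>D i p\<bar>"]) (auto intro: kernel_bound)

end

section \<open>Cancellation in the signed sum of second derivatives\<close>

text \<open>
  A signed sum of products of coefficients is the time derivative of a covariance. The first two
  conditions on \<open>D\<close> say that the covariances of vectors and of scalars change at opposite rates, \<open>disjoint\<close> that
  vectors and scalars are independent, and \<open>diagonal\<close> that the variances stay
  constant. The last condition guarantees that the vectors in a contributing pair do not
  degenerate at any time, the end points included.
\<close>
locale gaussian_norm_softmax =
  iid_std_normals M \<gamma> + norm_softmax I v c \<beta> s c3
  for M :: "'w measure" and \<gamma> :: "'k::finite \<Rightarrow> 'w \<Rightarrow> real"
    and I :: "'i set" and v :: "'i \<Rightarrow> 'k \<Rightarrow> 'e::euclidean_space" and c and \<beta> s c3 :: real +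
  fixes \<sigma> :: "'k \<Rightarrow> bool" and D :: "'i \<Rightarrow> 'i \<Rightarrow> real"
  assumes signed_v: "\<And>i p x y. (\<Sum>k\<in>UNIV. weight_sign \<sigma> k * ((x \<bullet> v i k) * (y \<bullet> v p k))) = - D i p * (x \<bullet> y)"
    and signed_c: "\<And>i p. (\<Sum>k\<in>UNIV. weight_sign \<sigma> k * (c i k * c p k)) = D i p"
    and disjoint: "\<And>i p k. c i k = 0 \<or> v p k = 0"
    and diagonal: "\<And>i. D i i = 0"
    and nondegenerate: "\<And>i p t. D i p \<noteq> 0 \<Longrightarrow> t \<in> {0..1} \<Longrightarrow>
          (\<exists>k. weight \<sigma> t k *\<^sub>R v i k \<noteq> 0) \<and> (\<exists>k. weight \<sigma> t k *\<^sub>R v p k \<noteq> 0)"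
begin

text \<open>
  The mixed terms between vector and scalar coefficients vanish by \<open>disjoint\<close>; the vector part
  contributes minus the cosine and the scalar part the constant \<open>1\<close>, because \<open>s\<^sup>2 = 1\<close>.
\<close>
lemma signed_q:
  "(\<Sum>k\<in>UNIV. weight_sign \<sigma> k * (q \<epsilon> i k z * q \<epsilon> p k z)) =
     D i p * (1 - (V i z \<bullet> V p z) / (R \<epsilon> i z * R \<epsilon> p z))"
proof -
  have "q \<epsilon> i k z * q \<epsilon> p k z =
      (V i z \<bullet> v i k) * (V p z \<bullet> v p k) / (R \<epsilon> i z * R \<epsilon> p z) + c i k * c p k" for k
  proof -
    have "c i k * (V p z \<bullet> v p k) = 0" "c p k * (V i z \<bullet> v i k) = 0"
      using disjoint[of i k p] disjoint[of p k i] by auto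
    then have *: "c i k * (s * (V p z \<bullet> v p k) / R \<epsilon> p z) = 0" "c p k * (s * (V i z \<bullet> v i k) / R \<epsilon> i z) = 0"
      by auto
    have "s * (V i z \<bullet> v i k) / R \<epsilon> i z * (s * (V p z \<bullet> v p k) / R \<epsilon> p z)
        = s\<^sup>2 * ((V i z \<bullet> v i k) * (V p z \<bullet> v p k) / (R \<epsilon> i z * R \<epsilon> p z))"
      by (simp add: power2_eq_square)
    moreover have "(a + b) * (a' + b') = a * a' + b * b'" if "b * a' = 0" "b' * a = 0" for a b a' b' :: real
      using that by (auto simp: distrib_left distrib_right)
    ultimately show ?thesis
      unfolding q_def using * s_sq by simp
  qed
  then have "(\<Sum>k\<in>UNIV. weight_sign \<sigma> k * (q \<epsilon> i k z * q \<epsilon> p k z)) =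
      (\<Sum>k\<in>UNIV. weight_sign \<sigma> k * ((V i z \<bullet> v i k) * (V p z \<bullet> v p k))) / (R \<epsilon> i z * R \<epsilon> p z)
      + (\<Sum>k\<in>UNIV. weight_sign \<sigma> k * (c i k * c p k))"
    by (simp add: distrib_left sum.distrib sum_divide_distrib)
  then show ?thesis
    unfolding signed_v signed_c by (simp add: algebra_simps)
qed

text \<open>
  The squared length of a coefficient vector is a sum over an orthonormal basis, and every resulting
  signed sum is a multiple of \<open>D i i = 0\<close>. This is where the second derivatives of the norms
  disappear.
\<close>
lemma signed_q': "(\<Sum>k\<in>UNIV. weight_sign \<sigma> k * q' \<epsilon> i k z) = 0"
proof -
  have "v i k \<bullet> v i k = (\<Sum>b\<in>Basis. (b \<bullet> v i k) * (b \<bullet> v i k))" for k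
    by (subst euclidean_inner) (simp add: inner_commute)
  then have "(\<Sum>k\<in>UNIV. weight_sign \<sigma> k * (v i k \<bullet> v i k)) =
      (\<Sum>b\<in>Basis. \<Sum>k\<in>UNIV. weight_sign \<sigma> k * ((b \<bullet> v i k) * (b \<bullet> v i k)))"
    by (simp add: sum_distrib_left) (rule sum.swap)
  also have "\<dots> = 0"
    unfolding signed_v diagonal by simp
  finally have 1: "(\<Sum>k\<in>UNIV. weight_sign \<sigma> k * (v i k \<bullet> v i k)) = 0" .
  have 2: "(\<Sum>k\<in>UNIV. weight_sign \<sigma> k * (V i z \<bullet> v i k)\<^sup>2) = 0"
    unfolding power2_eq_square signed_v diagonal by simp
  have "(\<Sum>k\<in>UNIV. weight_sign \<sigma> k * q' \<epsilon> i k z) =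
    s * ((\<Sum>k\<in>UNIV. weight_sign \<sigma> k * (v i k \<bullet> v i k)) / R \<epsilon> i z
      - (\<Sum>k\<in>UNIV. weight_sign \<sigma> k * (V i z \<bullet> v i k)\<^sup>2) / R \<epsilon> i z ^ 3)"
    unfolding q'_def sum_divide_distrib sum_subtractf[symmetric] sum_distrib_left
    by (intro sum.cong) (simp_all add: algebra_simps)
  then show ?thesis
    unfolding 1 2 by simp
qed

text \<open>
  Squaring the sum over \<open>i\<close> in \<open>F''\<close> gives a double sum over pairs, to which \<open>signed_q\<close> applies. The rest of \<open>F''\<close>
  involves single indices only and cancels.
\<close>
lemma signed_F'':
  "(\<Sum>k\<in>UNIV. weight_sign \<sigma> k * F'' \<epsilon> k z) =
     c3 * (c3 - 1) * \<beta>\<^sup>2 * (\<Sum>i\<in>I. \<Sum>p\<in>I. kernel D \<epsilon> i p z)"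
proof -
  let ?w = "weight_sign \<sigma>"
  have 1: "(\<Sum>k\<in>UNIV. ?w k * (\<Sum>i\<in>I. A \<epsilon> i z * q \<epsilon> i k z)\<^sup>2) =
      (\<Sum>i\<in>I. \<Sum>p\<in>I. A \<epsilon> i z * A \<epsilon> p z * (\<Sum>k\<in>UNIV. ?w k * (q \<epsilon> i k z * q \<epsilon> p k z)))"
  proof -
    have "(\<Sum>k\<in>UNIV. ?w k * (\<Sum>i\<in>I. A \<epsilon> i z * q \<epsilon> i k z)\<^sup>2) =
        (\<Sum>k\<in>UNIV. \<Sum>i\<in>I. \<Sum>p\<in>I. A \<epsilon> i z * A \<epsilon> p z * (?w k * (q \<epsilon> i k z * q \<epsilon> p k z)))"
      by (simp add: power2_eq_square sum_product sum_distrib_left mult_ac)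
    also have "\<dots> = (\<Sum>i\<in>I. \<Sum>p\<in>I. \<Sum>k\<in>UNIV. A \<epsilon> i z * A \<epsilon> p z * (?w k * (q \<epsilon> i k z * q \<epsilon> p k z)))"
      by (subst sum.swap, intro sum.cong refl, rule sum.swap)
    finally show ?thesis
      by (simp add: sum_distrib_left)
  qed
  have "(\<Sum>k\<in>UNIV. ?w k * (\<Sum>i\<in>I. A \<epsilon> i z * (\<beta> * (q \<epsilon> i k z)\<^sup>2 + q' \<epsilon> i k z))) =
      (\<Sum>i\<in>I. \<Sum>k\<in>UNIV. ?w k * (A \<epsilon> i z * (\<beta> * (q \<epsilon> i k z)\<^sup>2 + q' \<epsilon> i k z)))"
    unfolding sum_distrib_left by (rule sum.swap)
  also have "\<dots> = (\<Sum>i\<in>I. A \<epsilon> i z * (\<beta> * (\<Sum>k\<in>UNIV. ?w k * (q \<epsilon> i k z * q \<epsilon> i k z)) + (\<Sum>k\<in>UNIV. ?w k * q' \<epsilon> i k z)))"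
    unfolding sum_distrib_left sum.distrib[symmetric]
    by (intro sum.cong) (simp_all add: algebra_simps power2_eq_square)
  also have "\<dots> = 0"
    unfolding signed_q signed_q' diagonal by simp
  finally have 2: "(\<Sum>k\<in>UNIV. ?w k * (\<Sum>i\<in>I. A \<epsilon> i z * (\<beta> * (q \<epsilon> i k z)\<^sup>2 + q' \<epsilon> i k z))) = 0" .
  have "(\<Sum>k\<in>UNIV. ?w k * F'' \<epsilon> k z) =
      c3 * (c3 - 1) * \<beta>\<^sup>2 * (Z \<epsilon> z powr (c3 - 2) * (\<Sum>k\<in>UNIV. ?w k * (\<Sum>i\<in>I. A \<epsilon> i z * q \<epsilon> i k z)\<^sup>2))
      + c3 * \<beta> * (Z \<epsilon> z powr (c3 - 1) * (\<Sum>k\<in>UNIV. ?w k * (\<Sum>i\<in>I. A \<epsilon> i z * (\<beta> * (q \<epsilon> i k z)\<^sup>2 + q' \<epsilon> i k z))))"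
    unfolding F''_def distrib_left sum.distrib
    by (simp only: sum_distrib_left mult.left_commute[of "weight_sign \<sigma> _"])
  also have "\<dots> = c3 * (c3 - 1) * \<beta>\<^sup>2 * (Z \<epsilon> z powr (c3 - 2) *
      (\<Sum>i\<in>I. \<Sum>p\<in>I. A \<epsilon> i z * A \<epsilon> p z * (D i p * (1 - (V i z \<bullet> V p z) / (R \<epsilon> i z * R \<epsilon> p z)))))"
    unfolding 1 2 signed_q by simp
  also have "\<dots> = c3 * (c3 - 1) * \<beta>\<^sup>2 * (\<Sum>i\<in>I. \<Sum>p\<in>I. kernel D \<epsilon> i p z)"
  proof -
    have "Z \<epsilon> z powr (c3 - 2) = 1 / Z \<epsilon> z powr (2 - c3)"
      using powr_minus_divide[of "Z \<epsilon> z" "2 - c3"] by simp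
    then have "Z \<epsilon> z powr (c3 - 2) * (A \<epsilon> i z * A \<epsilon> p z * (D i p * x))
        = A \<epsilon> i z * A \<epsilon> p z / Z \<epsilon> z powr (2 - c3) * D i p * x" for i p x
      by simp
    then show ?thesis
      unfolding kernel_def sum_distrib_left by simp
  qed
  finally show ?thesis .
qed

section \<open>Removing the smoothing\<close>

text \<open>
  One coordinate of the vector is a linear form in the Gaussians with a nonzero coefficient.
\<close>
lemma path_V_nonzero:
  assumes "\<exists>k. weight \<sigma> t k *\<^sub>R v i k \<noteq> 0"
  shows "AE \<omega> in M. V i (path \<sigma> t \<omega>) \<noteq> 0"
proof -
  obtain k where "weight \<sigma> t k *\<^sub>R v i k \<noteq> 0"
    using assms by blast
  then obtain b where "(weight \<sigma> t k *\<^sub>R v i k) \<bullet> b \<noteq> 0"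
    using euclidean_all_zero_iff[of "weight \<sigma> t k *\<^sub>R v i k"] by blast
  then have "AE \<omega> in M. (\<Sum>j\<in>UNIV. ((weight \<sigma> t j *\<^sub>R v i j) \<bullet> b) * \<gamma> j \<omega>) \<noteq> 0"
    by (rule AE_linear_form_nonzero[of "\<lambda>j. (weight \<sigma> t j *\<^sub>R v i j) \<bullet> b"])
  then show ?thesis
  proof eventually_elim
    case (elim \<omega>)
    have "V i (path \<sigma> t \<omega>) \<bullet> b = (\<Sum>j\<in>UNIV. ((weight \<sigma> t j *\<^sub>R v i j) \<bullet> b) * \<gamma> j \<omega>)"
      unfolding V_def path_def by (simp add: inner_sum_left mult_ac)
    with elim show ?case
      by auto
  qed
qed

lemma path_R_nonzero:
  assumes "t \<in> {0..1}"
  shows "AE \<omega> in M. D i p \<noteq> 0 \<longrightarrow> R 0 i (path \<sigma> t \<omega>) \<noteq> 0 \<and> R 0 p (path \<sigma> t \<omega>) \<noteq> 0"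
proof (cases "D i p = 0")
  case False
  with nondegenerate[OF False assms]
  have "AE \<omega> in M. V i (path \<sigma> t \<omega>) \<noteq> 0" "AE \<omega> in M. V p (path \<sigma> t \<omega>) \<noteq> 0"
    by (intro path_V_nonzero; blast)+
  then show ?thesis
    by eventually_elim (simp add: R_0)
qed simp

definition \<Psi> :: "real \<Rightarrow> real \<Rightarrow> real" where
  "\<Psi> \<epsilon> t = expectation (\<lambda>\<omega>. F \<epsilon> (path \<sigma> t \<omega>))"

definition \<Phi> :: "real \<Rightarrow> real \<Rightarrow> real" where
  "\<Phi> \<epsilon> t = c3 * (c3 - 1) * \<beta>\<^sup>2 / 2 * (\<Sum>i\<in>I. \<Sum>p\<in>I. expectation (\<lambda>\<omega>. kernel D \<epsilon> i p (path \<sigma> t \<omega>)))"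

lemma integrable_F_path: "\<epsilon> \<in> {0..1} \<Longrightarrow> t \<in> {0..1} \<Longrightarrow> integrable M (\<lambda>\<omega>. F \<epsilon> (path \<sigma> t \<omega>))"
  by (intro integrable_path F_exp_growth) auto

lemma integrable_kernel_path:
  "\<epsilon> \<in> {0..1} \<Longrightarrow> t \<in> {0..1} \<Longrightarrow> i \<in> I \<Longrightarrow> p \<in> I \<Longrightarrow> integrable M (\<lambda>\<omega>. kernel D \<epsilon> i p (path \<sigma> t \<omega>))"
  by (intro integrable_path kernel_exp_growth) auto

text \<open>
  A single integrable function that dominates \<open>F\<close> at all times and for all smoothing parameters in
  \<open>[0, 1]\<close>.
\<close>
definition dominant :: "'w \<Rightarrow> real" where
  "dominant \<omega> = C_F * exp (c_F * (\<Sum>k\<in>UNIV. \<bar>\<gamma> k \<omega>\<bar>))"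

lemma integrable_dominant: "integrable M dominant"
  unfolding dominant_def by (intro integrable_mult_right integrable_exp_sum_abs)

lemma F_path_bound:
  assumes "\<epsilon> \<in> {0..1}" "t \<in> {0..1}"
  shows "\<bar>F \<epsilon> (path \<sigma> t \<omega>)\<bar> \<le> dominant \<omega>"
proof -
  have "\<bar>F \<epsilon> z\<bar> \<le> C_F * exp (c_F * (\<Sum>k\<in>UNIV. \<bar>z k\<bar>))" for z
    using F_bound[OF assms(1)] F_pos[of \<epsilon> z] by simp
  then show ?thesis
    unfolding dominant_def using growth_constants_nonneg assms(2) by (rule path_bound)
qed

lemma kernel_path_bound:
  assumes "\<epsilon> \<in> {0..1}" "t \<in> {0..1}" "i \<in> I" "p \<in> I"
  shows "\<bar>kernel D \<epsilon> i p (path \<sigma> t \<omega>)\<bar> \<le> 2 * \<bar>D i p\<bar> * dominant \<omega>"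
proof -
  have "\<bar>kernel D \<epsilon> i p (path \<sigma> t \<omega>)\<bar> \<le> 2 * \<bar>D i p\<bar> * F \<epsilon> (path \<sigma> t \<omega>)"
    using assms by (intro kernel_bound) auto
  also have "\<dots> \<le> 2 * \<bar>D i p\<bar> * dominant \<omega>"
    using F_path_bound[OF assms(1,2), of \<omega>] F_pos[of \<epsilon> "path \<sigma> t \<omega>"] by (intro mult_left_mono) auto
  finally show ?thesis .
qed

lemma tendsto_path: "((\<lambda>t. path \<sigma> t \<omega> k) \<longlongrightarrow> path \<sigma> t \<omega> k) (at t within S)"
proof -
  have "((\<lambda>t. weight \<sigma> t k) \<longlongrightarrow> weight \<sigma> t k) (at t within S)"
    using continuous_on_weight[of UNIV \<sigma> k]
    by (meson UNIV_I continuous_on_def subset_UNIV tendsto_within_subset)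
  then show ?thesis
    unfolding path_def by (intro tendsto_intros)
qed

lemma continuous_on_\<Psi>:
  assumes "\<epsilon> \<in> {0..1}"
  shows "continuous_on {0..1} (\<Psi> \<epsilon>)"
  unfolding \<Psi>_def
proof (rule continuous_on_lebesgue_integral[OF _ _ _ integrable_dominant])
  show "\<bar>F \<epsilon> (path \<sigma> t \<omega>)\<bar> \<le> dominant \<omega>" if "t \<in> {0..1}" for t \<omega>
    using assms that by (rule F_path_bound)
  show "AE \<omega> in M. continuous (at t within {0..1}) (\<lambda>t. F \<epsilon> (path \<sigma> t \<omega>))" for t
    unfolding continuous_within by (intro AE_I2 tendsto_F tendsto_const tendsto_path)
qed measurable

lemma continuous_on_\<Phi>: "continuous_on {0..1} (\<Phi> 0)"
  unfolding \<Phi>_def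
proof (intro continuous_on_mult continuous_on_const continuous_on_sum)
  fix i p assume ip: "i \<in> I" "p \<in> I"
  show "continuous_on {0..1} (\<lambda>t. expectation (\<lambda>\<omega>. kernel D 0 i p (path \<sigma> t \<omega>)))"
  proof (rule continuous_on_lebesgue_integral)
    show "\<bar>kernel D 0 i p (path \<sigma> t \<omega>)\<bar> \<le> 2 * \<bar>D i p\<bar> * dominant \<omega>" if "t \<in> {0..1}" for t \<omega>
      using that ip by (intro kernel_path_bound) auto
    show "AE \<omega> in M. continuous (at t within {0..1}) (\<lambda>t. kernel D 0 i p (path \<sigma> t \<omega>))" if "t \<in> {0..1}" for t
      using path_R_nonzero[OF that, of i p]
    proof eventually_elim
      case (elim \<omega>)
      then show ?case
        unfolding continuous_within by (intro tendsto_kernel tendsto_const tendsto_path) auto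
    qed
    show "integrable M (\<lambda>\<omega>. 2 * \<bar>D i p\<bar> * dominant \<omega>)"
      by (intro integrable_mult_right integrable_dominant)
  qed measurable
qed

lemma \<Psi>_smoothed_derivative:
  assumes "\<epsilon> \<in> {0<..1}" "t \<in> {0<..<1}"
  shows "(\<Psi> \<epsilon> has_real_derivative \<Phi> \<epsilon> t) (at t)"
proof -
  have \<epsilon>: "0 < \<epsilon>" "\<epsilon> \<in> {0..1}"
    using assms by auto
  have "((\<lambda>t. expectation (\<lambda>\<omega>. F \<epsilon> (path \<sigma> t \<omega>))) has_real_derivative
      expectation (\<lambda>\<omega>. \<Sum>k\<in>UNIV. weight_sign \<sigma> k * F'' \<epsilon> k (path \<sigma> t \<omega>)) / 2) (at t)"
  proof (rule interpolation_derivative[where f' = "F' \<epsilon>", OF assms(2) F_exp_growth measurable_F(1) F'_exp_growth measurable_F(2)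
        F''_exp_growth measurable_F(3)])
    show "((\<lambda>x. F \<epsilon> (z x)) has_real_derivative (\<Sum>k\<in>UNIV. z' k * F' \<epsilon> k (z t))) (at t)"
      if "\<And>k. ((\<lambda>x. z x k) has_real_derivative z' k) (at t)" for z z' t
      using \<epsilon>(1) that by (rule F_chain_rule)
    show "((\<lambda>y. F' \<epsilon> k (z(k := y))) has_real_derivative F'' \<epsilon> k (z(k := y))) (at y)" for k z y
      using \<epsilon>(1) by (rule F'_has_derivative)
    show "continuous_on UNIV (\<lambda>y. F'' \<epsilon> k (z(k := y)))" for k z
      unfolding continuous_on_def
    proof (intro ballI tendsto_F'' tendsto_const \<epsilon>(1))
      show "((\<lambda>y. (z(k := y)) j) \<longlongrightarrow> (z(k := y)) j) (at y)" for y j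
        by (cases "j = k") auto
    qed
  qed (use assms \<epsilon> in auto)
  moreover have "expectation (\<lambda>\<omega>. \<Sum>k\<in>UNIV. weight_sign \<sigma> k * F'' \<epsilon> k (path \<sigma> t \<omega>)) / 2 = \<Phi> \<epsilon> t"
  proof -
    have "expectation (\<lambda>\<omega>. \<Sum>i\<in>I. \<Sum>p\<in>I. kernel D \<epsilon> i p (path \<sigma> t \<omega>))
        = (\<Sum>i\<in>I. \<Sum>p\<in>I. expectation (\<lambda>\<omega>. kernel D \<epsilon> i p (path \<sigma> t \<omega>)))"
      using assms(2) \<epsilon>(2)
      by (intro has_bochner_integral_integral_eq has_bochner_integral_sum has_bochner_integral_integrable
          integrable_kernel_path) auto
    then show ?thesis
      unfolding signed_F'' \<Phi>_def by simp
  qed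
  ultimately show ?thesis
    unfolding \<Psi>_def by simp
qed

lemma \<Psi>_tendsto:
  assumes "t \<in> {0..1}" "\<And>n. e n \<in> {0..1}" "e \<longlonglongrightarrow> 0"
  shows "(\<lambda>n. \<Psi> (e n) t) \<longlonglongrightarrow> \<Psi> 0 t"
  unfolding \<Psi>_def
proof (rule integral_dominated_convergence[OF _ _ integrable_dominant])
  show "AE \<omega> in M. (\<lambda>n. F (e n) (path \<sigma> t \<omega>)) \<longlonglongrightarrow> F 0 (path \<sigma> t \<omega>)"
    by (intro AE_I2 tendsto_F assms tendsto_const)
  show "AE \<omega> in M. norm (F (e n) (path \<sigma> t \<omega>)) \<le> dominant \<omega>" for n
    using F_path_bound[OF assms(2,1)] by simp
qed measurable

lemma \<Phi>_tendsto:
  assumes "t \<in> {0..1}" "\<And>n. e n \<in> {0..1}" "e \<longlonglongrightarrow> 0"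
  shows "(\<lambda>n. \<Phi> (e n) t) \<longlonglongrightarrow> \<Phi> 0 t"
  unfolding \<Phi>_def
proof (intro tendsto_mult tendsto_const tendsto_sum)
  fix i p assume ip: "i \<in> I" "p \<in> I"
  show "(\<lambda>n. expectation (\<lambda>\<omega>. kernel D (e n) i p (path \<sigma> t \<omega>))) \<longlonglongrightarrow> expectation (\<lambda>\<omega>. kernel D 0 i p (path \<sigma> t \<omega>))"
  proof (rule integral_dominated_convergence)
    show "AE \<omega> in M. (\<lambda>n. kernel D (e n) i p (path \<sigma> t \<omega>)) \<longlonglongrightarrow> kernel D 0 i p (path \<sigma> t \<omega>)"
      using path_R_nonzero[OF assms(1), of i p]
      by eventually_elim (intro tendsto_kernel assms tendsto_const; blast)
    show "AE \<omega> in M. norm (kernel D (e n) i p (path \<sigma> t \<omega>)) \<le> 2 * \<bar>D i p\<bar> * dominant \<omega>" for n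
      using kernel_path_bound[OF assms(2,1) ip] by simp
    show "integrable M (\<lambda>\<omega>. 2 * \<bar>D i p\<bar> * dominant \<omega>)"
      by (intro integrable_mult_right integrable_dominant)
  qed measurable
qed

lemma \<Phi>_bounded:
  assumes "\<epsilon> \<in> {0..1}" "t \<in> {0..1}"
  shows "\<bar>\<Phi> \<epsilon> t\<bar> \<le> \<bar>c3 * (c3 - 1) * \<beta>\<^sup>2 / 2\<bar> * (\<Sum>i\<in>I. \<Sum>p\<in>I. 2 * \<bar>D i p\<bar> * expectation dominant)"
  unfolding \<Phi>_def abs_mult[of "c3 * (c3 - 1) * \<beta>\<^sup>2 / 2"]
proof (intro mult_left_mono order_trans[OF sum_abs] sum_mono abs_ge_zero)
  fix i p assume ip: "i \<in> I" "p \<in> I"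
  have "\<bar>expectation (\<lambda>\<omega>. kernel D \<epsilon> i p (path \<sigma> t \<omega>))\<bar> \<le> expectation (\<lambda>\<omega>. \<bar>kernel D \<epsilon> i p (path \<sigma> t \<omega>)\<bar>)"
    by (rule integral_abs_bound)
  also have "\<dots> \<le> expectation (\<lambda>\<omega>. 2 * \<bar>D i p\<bar> * dominant \<omega>)"
    using assms ip
    by (intro integral_mono kernel_path_bound integrable_mult_right integrable_dominant
        integrable_abs integrable_kernel_path)
  finally show "\<bar>expectation (\<lambda>\<omega>. kernel D \<epsilon> i p (path \<sigma> t \<omega>))\<bar> \<le> 2 * \<bar>D i p\<bar> * expectation dominant"
    by simp
qed

text \<open>
  For the smoothed functional this is the fundamental theorem of calculus; the derivative is known
  in the open interval only, where the weights are differentiable, which suffices by continuity at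
  the end points. In integrated form, pointwise bounded convergence of the derivatives is enough to pass to \<open>\<epsilon> = 0\<close>.
\<close>
lemma \<Psi>_integral:
  assumes "t \<in> {0..1}"
  shows "(\<Phi> 0 has_integral (\<Psi> 0 t - \<Psi> 0 0)) {0..t}"
proof (rule has_integral_dominated_convergence)
  define e :: "nat \<Rightarrow> real" where "e n = 1 / real (Suc n)" for n
  have e: "e n \<in> {0<..1}" "e n \<in> {0..1}" "e \<longlonglongrightarrow> 0" for n
    unfolding e_def by (simp, simp, rule LIMSEQ_Suc[OF lim_1_over_n])
  have sub: "{0..t} \<subseteq> {0..1}"
    using assms by auto
  show "(\<Phi> (e n) has_integral (\<Psi> (e n) t - \<Psi> (e n) 0)) {0..t}" for n
  proof (rule fundamental_theorem_of_calculus_interior)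
    show "continuous_on {0..t} (\<Psi> (e n))"
      using continuous_on_\<Psi>[OF e(2)] sub by (rule continuous_on_subset)
    show "(\<Psi> (e n) has_vector_derivative \<Phi> (e n) x) (at x)" if "x \<in> {0<..<t}" for x
      unfolding has_real_derivative_iff_has_vector_derivative[symmetric]
      using that assms by (intro \<Psi>_smoothed_derivative e) auto
  qed (use assms in auto)
  show "\<forall>x\<in>{0..t}. norm (\<Phi> (e n) x)
      \<le> \<bar>c3 * (c3 - 1) * \<beta>\<^sup>2 / 2\<bar> * (\<Sum>i\<in>I. \<Sum>p\<in>I. 2 * \<bar>D i p\<bar> * expectation dominant)" for n
    using \<Phi>_bounded[OF e(2)] sub by auto
  show "\<forall>x\<in>{0..t}. (\<lambda>n. \<Phi> (e n) x) \<longlonglongrightarrow> \<Phi> 0 x"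
    using \<Phi>_tendsto[OF _ e(2,3)] sub by auto
  show "(\<lambda>n. \<Psi> (e n) t - \<Psi> (e n) 0) \<longlonglongrightarrow> \<Psi> 0 t - \<Psi> 0 0"
    using assms by (intro tendsto_diff \<Psi>_tendsto e) auto
qed (rule integrable_const_ivl)

text \<open>
  Since \<open>\<Phi> 0\<close> is continuous up to the end points, the integral has one-sided derivatives there, although
  \<open>sqrt t\<close> has none at \<open>0\<close> and \<open>sqrt (1 - t)\<close> none at \<open>1\<close>.
\<close>
lemma \<Psi>_derivative_within:
  assumes "t \<in> {0..1}"
  shows "(\<Psi> 0 has_real_derivative \<Phi> 0 t) (at t within {0..1})"
proof -
  have "((\<lambda>x. \<Psi> 0 0 + integral {0..x} (\<Phi> 0)) has_real_derivative 0 + \<Phi> 0 t) (at t within {0..1})"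
    using assms continuous_on_\<Phi> by (intro DERIV_add DERIV_const integral_has_real_derivative)
  then have "((\<lambda>x. \<Psi> 0 0 + integral {0..x} (\<Phi> 0)) has_real_derivative \<Phi> 0 t) (at t within {0..1})"
    by simp
  moreover have "\<Psi> 0 0 + integral {0..x} (\<Phi> 0) = \<Psi> 0 x" if "x \<in> {0..1}" for x
    using integral_unique[OF \<Psi>_integral[OF that]] by simp
  ultimately show ?thesis
    by (rule has_field_derivative_transform_within[OF _ zero_less_one assms])
qed

lemma \<Psi>_derivative:
  assumes "t \<in> {0<..<1}"
  shows "(\<Psi> 0 has_real_derivative \<Phi> 0 t) (at t)"
proof -
  have "(\<Psi> 0 has_real_derivative \<Phi> 0 t) (at t within {0..1})"
    using assms by (intro \<Psi>_derivative_within) auto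
  moreover have "at t within {0..1} = at t"
    using assms by (intro at_within_interior) (auto simp: interior_atLeastAtMost_real)
  ultimately show ?thesis
    by simp
qed

end

section \<open>From a derivative to the integral representation\<close>

text \<open>
  The function \<open>deriv \<psi>\<close> is unspecified at the end points when \<open>\<psi>\<close> has one-sided derivatives there only;
  the interval integral ignores them.
\<close>
lemma deriv_integral_representation:
  fixes \<psi> \<phi> :: "real \<Rightarrow> real"
  assumes cont: "continuous_on {0..1} \<phi>"
    and within: "\<And>t. t \<in> {0..1} \<Longrightarrow> (\<psi> has_real_derivative \<phi> t) (at t within {0..1})"
    and inside: "\<And>t. t \<in> {0<..<1} \<Longrightarrow> (\<psi> has_real_derivative \<phi> t) (at t)"
    and t: "t \<in> {0..1}"
  shows "interval_lebesgue_integrable lborel 0 (ereal t) (deriv \<psi>)"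
    and "\<psi> t = \<psi> 0 + (LBINT \<tau>=0..ereal t. deriv \<psi> \<tau>)"
proof -
  have sub: "{0..t} \<subseteq> {0..1}"
    using t by auto
  have eq: "deriv \<psi> \<tau> = \<phi> \<tau>" if "\<tau> \<in> einterval 0 (ereal t)" for \<tau>
    using that t by (intro DERIV_imp_deriv inside) (auto simp: einterval_iff)
  have "set_integrable lborel {0..t} \<phi>"
    using borel_integrable_atLeastAtMost'[OF continuous_on_subset[OF cont sub]] .
  then have "set_integrable lborel (einterval 0 (ereal t)) \<phi>"
    by (rule set_integrable_subset) (auto simp: einterval_iff)
  then have "set_integrable lborel (einterval 0 (ereal t)) (deriv \<psi>)"
    by (subst set_integrable_cong[OF refl refl eq]) auto
  then show "interval_lebesgue_integrable lborel 0 (ereal t) (deriv \<psi>)"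
    using t by (simp add: interval_lebesgue_integrable_def)
  have "(LBINT \<tau>=ereal 0..ereal t. \<phi> \<tau>) = \<psi> t - \<psi> 0"
  proof (rule interval_integral_FTC_finite)
    show "continuous_on {min 0 t..max 0 t} \<phi>"
      using continuous_on_subset[OF cont sub] t by simp
    show "(\<psi> has_vector_derivative \<phi> \<tau>) (at \<tau> within {min 0 t..max 0 t})"
      if "min 0 t \<le> \<tau>" "\<tau> \<le> max 0 t" for \<tau>
    proof -
      have "min 0 t = 0" "max 0 t = t" "\<tau> \<in> {0..1}"
        using that t by auto
      then show ?thesis
        using within[of \<tau>] sub
        by (auto simp: has_real_derivative_iff_has_vector_derivative intro: has_vector_derivative_within_subset)
    qed
  qed
  moreover have "(LBINT \<tau>=0..ereal t. deriv \<psi> \<tau>) = (LBINT \<tau>=ereal 0..ereal t. \<phi> \<tau>)"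
    unfolding zero_ereal_def[symmetric] using t by (intro interval_integral_cong eq) (auto simp: min_def max_def)
  ultimately show "\<psi> t = \<psi> 0 + (LBINT \<tau>=0..ereal t. deriv \<psi> \<tau>)"
    by simp
qed

section \<open>The Gaussian matrix, vectors and scalar as one family\<close>

lemma sum_gaussian_index:
  fixes f :: "('m::finite \<times> 'n::finite) + 'm + 'n + unit \<Rightarrow> 'a::comm_monoid_add"
  shows "(\<Sum>k\<in>UNIV. f k) = (\<Sum>a\<in>UNIV. \<Sum>b\<in>UNIV. f (Inl (a, b))) + ((\<Sum>a\<in>UNIV. f (Inr (Inl a))) +
    ((\<Sum>b\<in>UNIV. f (Inr (Inr (Inl b)))) + f (Inr (Inr (Inr ())))))"
  by (simp add: UNIV_Plus_UNIV[symmetric] sum.Plus UNIV_Times_UNIV[symmetric] sum.cartesian_product UNIV_unit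
      del: UNIV_Plus_UNIV UNIV_Times_UNIV)

text \<open>
  The coefficients of \<open>G *v y + norm y *\<^sub>R u2\<close>, and below in \<open>scalar_coeff\<close> those of
  \<open>norm y * u4 + h \<bullet> y\<close>, as linear forms in the family \<open>gaussian_entry\<close>.
\<close>
fun vector_coeff :: "real^'n \<Rightarrow> ('m \<times> 'n) + 'm + 'n + unit \<Rightarrow> real^'m" where
  "vector_coeff y (Inl (a, b)) = (y $ b) *\<^sub>R axis a 1"
| "vector_coeff y (Inr (Inl a)) = norm y *\<^sub>R axis a 1"
| "vector_coeff y (Inr (Inr _)) = 0"

fun scalar_coeff :: "real^'n \<Rightarrow> ('m \<times> 'n) + 'm + 'n + unit \<Rightarrow> real" where
  "scalar_coeff y (Inr (Inr (Inl b))) = y $ b"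
| "scalar_coeff y (Inr (Inr (Inr _))) = norm y"
| "scalar_coeff y _ = 0"

fun grows_in_time :: "('m \<times> 'n) + 'm + 'n + unit \<Rightarrow> bool" where
  "grows_in_time (Inl _) = True"
| "grows_in_time (Inr (Inl _)) = False"
| "grows_in_time (Inr (Inr (Inl _))) = False"
| "grows_in_time (Inr (Inr (Inr _))) = True"

text \<open>
  The entries of \<open>G\<close> contribute \<open>(y \<bullet> w) * (X \<bullet> Y)\<close> with a positive sign and those of \<open>u2\<close> contribute
  \<open>norm y * norm w * (X \<bullet> Y)\<close> with a negative sign.
\<close>
lemma signed_vector_coeff:
  fixes y w :: "real^'n" and X Y :: "real^'m"
  shows "(\<Sum>k\<in>UNIV. weight_sign grows_in_time k * ((X \<bullet> vector_coeff y k) * (Y \<bullet> vector_coeff w k))) =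
    - (norm y * norm w - y \<bullet> w) * (X \<bullet> Y)"
proof -
  have "(\<Sum>k\<in>UNIV. weight_sign grows_in_time k * ((X \<bullet> vector_coeff y k) * (Y \<bullet> vector_coeff w k))) =
      (\<Sum>a\<in>UNIV. \<Sum>b\<in>UNIV. (X $ a * Y $ a) * (y $ b * w $ b)) - (\<Sum>a\<in>UNIV. norm y * norm w * (X $ a * Y $ a))"
    unfolding sum_gaussian_index
    by (simp add: weight_sign_def inner_axis sum_negf mult_ac)
  also have "\<dots> = (X \<bullet> Y) * (y \<bullet> w) - norm y * norm w * (X \<bullet> Y)"
    by (simp add: inner_vec_def flip: sum_distrib_left sum_distrib_right)
  finally show ?thesis
    by (simp add: algebra_simps)
qed

lemma signed_scalar_coeff:
  fixes y w :: "real^'n"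
  shows "(\<Sum>k\<in>(UNIV :: (('m::finite \<times> 'n) + 'm + 'n + unit) set).
      weight_sign grows_in_time k * (scalar_coeff y k * scalar_coeff w k)) = norm y * norm w - y \<bullet> w"
  unfolding sum_gaussian_index by (simp add: weight_sign_def inner_vec_def sum_negf)

text \<open>
  At time \<open>0\<close> only \<open>u2\<close> is present and supplies the witness; at later times \<open>G\<close> does.
\<close>
lemma vector_coeff_nonzero:
  fixes y :: "real^'n"
  assumes "y \<noteq> 0" "t \<in> {0..1}"
  shows "\<exists>k. weight grows_in_time t k *\<^sub>R (vector_coeff y k :: real^'m) \<noteq> 0"
proof (cases "t = 0")
  case True
  then show ?thesis
    using assms(1) by (intro exI[of _ "Inr (Inl undefined)"]) (simp add: weight_def)
next
  case False
  obtain b where "y $ b \<noteq> 0"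
    using assms(1) by (auto simp: vec_eq_iff)
  then show ?thesis
    using False assms(2) by (intro exI[of _ "Inl (undefined, b)"]) (simp add: weight_def)
qed

text \<open>
  This form avoids division and covers \<open>y = 0\<close>, where both sides vanish.
\<close>
lemma norm_scaleR_B_vec:
  "norm y *\<^sub>R B_vec t G u2 y = sqrt t *\<^sub>R (G *v y) + (sqrt (1 - t) * norm y) *\<^sub>R u2"
  by (cases "y = 0") (simp_all add: B_vec_def u1_def scaleR_add_right mult.commute)

section \<open>Derivative and integral representation of the interpolated functional\<close>

theorem theorem3:
  fixes M :: "'w measure"
    and G :: "'w \<Rightarrow> real^'n^'m" and u2 :: "'w \<Rightarrow> real^'m"
    and h :: "'w \<Rightarrow> real^'n" and u4 :: "'w \<Rightarrow> real"
    and x :: "nat \<Rightarrow> real^'n" and l :: nat and \<beta> s c3 :: real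
  assumes "prob_space M"
    and "prob_space.indep_vars M (\<lambda>_. borel) (gaussian_entry G u2 h u4) UNIV"
    and "\<And>k. distributed M lborel (gaussian_entry G u2 h u4 k) std_normal_density"
    and "l \<ge> 1" and "\<beta> > 0" and "c3 \<ge> 0" and "s \<in> {-1, 1}"
  shows
    "(\<forall>t\<in>{0..1}.
        integrable M (\<lambda>\<omega>. psi_integrand x l \<beta> s c3 t (G \<omega>) (u2 \<omega>) (h \<omega>) (u4 \<omega>)))
     \<and> (\<forall>t\<in>{0..1}.
        interval_lebesgue_integrable lborel 0 t (deriv (psi M G u2 h u4 x l \<beta> s c3))
        \<and> psi M G u2 h u4 x l \<beta> s c3 t =
            psi M G u2 h u4 x l \<beta> s c3 0 + (LBINT \<tau>=0..t. deriv (psi M G u2 h u4 x l \<beta> s c3) \<tau>))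
     \<and> (\<forall>t\<in>{0<..<1}.
        (\<forall>i\<in>{1..l}. \<forall>p\<in>{1..l}.
          integrable M (\<lambda>\<omega>. deriv_summand x l \<beta> s c3 t (G \<omega>) (u2 \<omega>) (h \<omega>) (u4 \<omega>) i p))
        \<and> (psi M G u2 h u4 x l \<beta> s c3 has_real_derivative
            - (\<beta>\<^sup>2 * c3 * (1 - c3) / 2) *
              (\<Sum>i=1..l. \<Sum>p=1..l.
                \<integral>\<omega>. deriv_summand x l \<beta> s c3 t (G \<omega>) (u2 \<omega>) (h \<omega>) (u4 \<omega>) i p \<partial>M)) (at t))"
proof -
  let ?\<gamma> = "gaussian_entry G u2 h u4"
  define D where "D i p = norm (x i) * norm (x p) - x i \<bullet> x p" for i p
  define v :: "nat \<Rightarrow> ('m \<times> 'n) + 'm + 'n + unit \<Rightarrow> real^'m" where "v i = vector_coeff (x i)" for i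
  define c :: "nat \<Rightarrow> ('m \<times> 'n) + 'm + 'n + unit \<Rightarrow> real" where "c i = scalar_coeff (x i)" for i
  interpret prob_space M
    by fact
  interpret gaussian_norm_softmax M ?\<gamma> "{1..l}" v c \<beta> s c3 grows_in_time D
  proof
    show "indep_vars (\<lambda>_. borel) ?\<gamma> UNIV" "distributed M lborel (?\<gamma> k) std_normal_density" for k
      using assms(2,3) by simp_all
    show "finite {1..l}" "{1..l} \<noteq> {}" "s\<^sup>2 = 1" "0 \<le> \<beta>" "0 \<le> c3"
      using assms(4-7) by auto
    show "(\<Sum>k\<in>UNIV. weight_sign grows_in_time k * ((X \<bullet> v i k) * (Y \<bullet> v p k))) = - D i p * (X \<bullet> Y)" for i p X Y
      unfolding v_def D_def by (rule signed_vector_coeff)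
    show "(\<Sum>k\<in>UNIV. weight_sign grows_in_time k * (c i k * c p k)) = D i p" for i p
      unfolding c_def D_def by (rule signed_scalar_coeff)
    show "c i k = 0 \<or> v p k = 0" for i p k
      unfolding c_def v_def by (cases "(x i, k)" rule: scalar_coeff.cases) auto
    show "D i i = 0" for i
      by (simp add: D_def power2_norm_eq_inner[symmetric] power2_eq_square)
    show "(\<exists>k. weight grows_in_time t k *\<^sub>R v i k \<noteq> 0) \<and> (\<exists>k. weight grows_in_time t k *\<^sub>R v p k \<noteq> 0)"
      if "D i p \<noteq> 0" "t \<in> {0..1}" for i p t
    proof -
      have "x i \<noteq> 0" "x p \<noteq> 0"
        using that(1) by (auto simp: D_def)
      then show ?thesis
        unfolding v_def using that(2) by (intro conjI vector_coeff_nonzero)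
    qed
  qed
  have V: "V i (path grows_in_time t \<omega>) = norm (x i) *\<^sub>R B_vec t (G \<omega>) (u2 \<omega>) (x i)" for i t \<omega>
  proof -
    have "(\<Sum>a\<in>UNIV. \<Sum>b\<in>UNIV. if j = a then f a b else 0) = (\<Sum>b\<in>UNIV. f j b)"
      for j and f :: "'m \<Rightarrow> 'n \<Rightarrow> real"
      by (subst sum.swap) simp
    then show ?thesis
      unfolding norm_scaleR_B_vec V_def path_def v_def sum_gaussian_index
      by (simp add: vec_eq_iff weight_def matrix_vector_mult_def axis_def sum_distrib_left mult_ac
          if_distrib cong: if_cong)
  qed
  have R: "R 0 i (path grows_in_time t \<omega>) = norm (x i) * B_norm t (G \<omega>) (u2 \<omega>) (x i)" for i t \<omega>
    by (simp add: R_0 V B_norm_def)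
  have W: "W i (path grows_in_time t \<omega>) = sqrt t * norm (x i) * u4 \<omega> + sqrt (1 - t) * (h \<omega> \<bullet> x i)" for i t \<omega>
    unfolding W_def path_def c_def sum_gaussian_index
    by (simp add: weight_def inner_vec_def sum_distrib_left mult_ac)
  have A: "A 0 i (path grows_in_time t \<omega>) = A_star \<beta> s t (G \<omega>) (u2 \<omega>) (h \<omega>) (u4 \<omega>) (x i)" for i t \<omega>
    by (cases "x i = 0") (simp_all add: A_def A_star_def R W u3_def algebra_simps)
  have Z: "Z 0 (path grows_in_time t \<omega>) = Z_star x l \<beta> s t (G \<omega>) (u2 \<omega>) (h \<omega>) (u4 \<omega>)" for t \<omega>
    unfolding Z_def Z_star_def A ..
  have F: "psi_integrand x l \<beta> s c3 t (G \<omega>) (u2 \<omega>) (h \<omega>) (u4 \<omega>) = F 0 (path grows_in_time t \<omega>)" for t \<omega>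
    unfolding psi_integrand_def F_def Z_def A_def R_0 V W norm_scaleR_B_vec by (simp add: add.assoc)
  \<comment> \<open>If one of the two vectors is zero, both sides are zero because of the factor \<open>D i p\<close>.\<close>
  have kernel: "deriv_summand x l \<beta> s c3 t (G \<omega>) (u2 \<omega>) (h \<omega>) (u4 \<omega>) i p = kernel D 0 i p (path grows_in_time t \<omega>)"
    for t \<omega> i p
    unfolding deriv_summand_def kernel_def A Z R V D_def
    by (cases "x i = 0 \<or> x p = 0") auto
  have psi: "psi M G u2 h u4 x l \<beta> s c3 = \<Psi> 0"
    unfolding psi_def \<Psi>_def F fun_eq_iff by simp
  have "\<Phi> 0 t = - (\<beta>\<^sup>2 * c3 * (1 - c3) / 2) *
      (\<Sum>i=1..l. \<Sum>p=1..l. \<integral>\<omega>. deriv_summand x l \<beta> s c3 t (G \<omega>) (u2 \<omega>) (h \<omega>) (u4 \<omega>) i p \<partial>M)" for t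
  proof -
    have "c3 * (c3 - 1) * \<beta>\<^sup>2 / 2 = - (\<beta>\<^sup>2 * c3 * (1 - c3) / 2)"
      by (simp add: field_simps)
    then show ?thesis
      unfolding \<Phi>_def kernel by (simp only:)
  qed
  then have deriv: "(\<Psi> 0 has_real_derivative - (\<beta>\<^sup>2 * c3 * (1 - c3) / 2) *
      (\<Sum>i=1..l. \<Sum>p=1..l. \<integral>\<omega>. deriv_summand x l \<beta> s c3 t (G \<omega>) (u2 \<omega>) (h \<omega>) (u4 \<omega>) i p \<partial>M)) (at t)"
    if "t \<in> {0<..<1}" for t
    using \<Psi>_derivative[OF that] by simp
  show ?thesis
    unfolding psi
  proof (intro conjI ballI)
    show "integrable M (\<lambda>\<omega>. psi_integrand x l \<beta> s c3 t (G \<omega>) (u2 \<omega>) (h \<omega>) (u4 \<omega>))" if "t \<in> {0..1}" for t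
      unfolding F using that by (intro integrable_F_path) auto
    show "interval_lebesgue_integrable lborel 0 (ereal t) (deriv (\<Psi> 0))"
      "\<Psi> 0 t = \<Psi> 0 0 + (LBINT \<tau>=0..ereal t. deriv (\<Psi> 0) \<tau>)" if "t \<in> {0..1}" for t
      using deriv_integral_representation[OF continuous_on_\<Phi> \<Psi>_derivative_within \<Psi>_derivative that] by blast+
    show "integrable M (\<lambda>\<omega>. deriv_summand x l \<beta> s c3 t (G \<omega>) (u2 \<omega>) (h \<omega>) (u4 \<omega>) i p)"
      if "t \<in> {0<..<1}" "i \<in> {1..l}" "p \<in> {1..l}" for t i p
      unfolding kernel using that by (intro integrable_kernel_path) auto
  qed (rule deriv)
qed

end
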